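(* Let $\chi \in \widehat{\mathcal{O}^{\times}}$ and $m \geq c(\chi)$, and let $\{Q_j\}$ be an orthonormal basis of $\mathcal{H}_{\chi,m}(S^{n-1})$. Then for any $x \in S^{n-1}$ and $k \in K$, we have that \[\sum_{j=1}^{\dim \mathcal{H}_{\chi,m}(S^{n-1})} Q_j(x)\,\overline{Q_j(e_n k)} = \dim \mathcal{H}_{\chi,m}(S^{n-1})\; P_{\chi,m}^{\circ}(xk^{-1}).\]
   Context: Let $F$ be a nonarchimedean local field with ring of integers $\mathcal{O}$, maximal ideal $\mathfrak{p}$, uniformiser $\varpi$, residue field of order $q$, and absolute value normalised by $|\varpi| = q^{-1}$. Fix $n \geq 2$ and let $K = \mathrm{GL}_n(\mathcal{O})$ with Haar probability measure $dk$. Let \[K_{n-1,1} = \left\{\begin{pmatrix} a & b \\ 0 & 1\end{pmatrix} \in K : a \in \mathrm{GL}_{n-1}(\mathcal{O}),\ b \in \mathrm{Mat}_{(n-1)\times 1}(\mathcal{O})\right\}.\] Let $S^{n-1} = \{x \in F^n : \max\{|x_1|,\ldots,|x_n|\} = 1\}$ (row vectors), on which $K$ acts by $k \cdot x = xk$, and let $e_n = (0,\ldots,0,1)$. $C^{\infty}(S^{n-1})$ is the space of locally constant functions $f : S^{n-1} \to \mathbb{C}$, with inner product $\langle f_1,f_2\rangle = \int_K f_1(e_n k)\overline{f_2(e_n k)}\,dk$. For $m \geq 0$, $K(\mathfrak{p}^m) = \{k \in K : k - 1_n \in \mathrm{Mat}_{n\times n}(\mathfrak{p}^m)\}$. $\widehat{\mathcal{O}^{\times}}$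 is the set of continuous characters $\chi : \mathcal{O}^{\times} \to \mathbb{C}^{\times}$. The conductor exponent $c(\chi)$ is the least nonnegative integer $m$ such that $\chi$ is trivial on $1+\mathfrak{p}^m$ (on $\mathcal{O}^{\times}$ if $m=0$). Let $C^{\infty}(S^{n-1})_{\chi}^{K(\mathfrak{p}^m)}$ be the space of $f \in C^{\infty}(S^{n-1})$ with $f(xk) = f(x)$ for all $k \in K(\mathfrak{p}^m)$ and $f(ax) = \chi(a) f(x)$ for all $a \in \mathcal{O}^{\times}$. For $m \geq c(\chi)$, $\mathcal{H}_{\chi,m}(S^{n-1})$ is $C^{\infty}(S^{n-1})_{\chi}^{K(\mathfrak{p}^{c(\chi)})}$ if $m = c(\chi)$, and the orthogonal complement of $C^{\infty}(S^{n-1})_{\chi}^{K(\mathfrak{p}^{m-1})}$ in $C^{\infty}(S^{n-1})_{\chi}^{K(\mathfrak{p}^m)}$ if $m > c(\chi)$; it is finite-dimensional. $P_{\chi,m}^{\circ}$ (the zonal spherical function of character $\chi$ and level $m$) denotes the unique function in $\mathcal{H}_{\chi,m}(S^{n-1})$ satisfying $P_{\chi,m}^{\circ}(xk') = P_{\chi,m}^{\circ}(x)$ for all $x \in S^{n-1}$, $k' \in K_{n-1,1}$, and $P_{\chi,m}^{\circ}(e_n) = 1$. *)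

theory Defs
  imports "HOL-Probability.Probability_Measure" "HOL-Library.Function_Algebras"
begin

section \<open>Nonarchimedean local fields\<close>

text \<open>The absolute value of the field induces its metric and hence its topology.  It is not called
  \<open>norm\<close> because the library constrains that constant to real normed vector spaces.\<close>

class nonarch_field = field + complete_space +
  fixes absval :: "'a \<Rightarrow> real"
  assumes dist_absval: "dist x y = absval (x - y)"
    and absval_times: "absval (x * y) = absval x * absval y"
    and absval_plus_le_max: "absval (x + y) \<le> max (absval x) (absval y)"
begin

definition integers :: "'a set" where
  "integers = {x. absval x \<le> 1}"

definition maximal_ideal :: "'a set" where
  "maximal_ideal = {x. absval x < 1}"

definition residue_field :: "'a set set" where
  "residue_field = integers // {(x, y). x \<in> integers \<and> y \<in> integers \<and> x - y \<in> maximal_ideal}"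

definition uniformiser :: "'a \<Rightarrow> bool" where
  "uniformiser w \<longleftrightarrow> w \<noteq> 0 \<and> maximal_ideal = {w * a | a. a \<in> integers}"

end

text \<open>The last axiom normalises the absolute value.\<close>

class nonarch_local_field = nonarch_field +
  assumes uniformiser_exists: "\<exists>w. uniformiser w"
    and finite_residue_field: "finite residue_field"
    and absval_uniformiser: "uniformiser w \<Longrightarrow> absval w = inverse (real (card residue_field))"

text \<open>The power \<open>\<pp>\<^sup>m\<close> of the maximal ideal is generated by \<open>w ^ m\<close>, whichever uniformiser \<open>w\<close>
  is chosen.\<close>

definition ideal_power :: "nat \<Rightarrow> 'a::nonarch_local_field set" where
  "ideal_power m = {w ^ m * a | w a. uniformiser w \<and> a \<in> integers}"

definition integer_units :: "'a::nonarch_local_field set" where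
  "integer_units = {a \<in> integers. \<exists>b \<in> integers. a * b = 1}"

section \<open>Characters\<close>

text \<open>A character is written \<open>\<omega>\<close>, as \<open>\<chi>\<close> is the binder for vectors.  Only its values on
  \<open>integer_units\<close> matter.\<close>

definition unit_character :: "('a::nonarch_local_field \<Rightarrow> complex) \<Rightarrow> bool" where
  "unit_character \<omega> \<longleftrightarrow>
     (\<forall>a \<in> integer_units. \<omega> a \<noteq> 0) \<and>
     (\<forall>a \<in> integer_units. \<forall>b \<in> integer_units. \<omega> (a * b) = \<omega> a * \<omega> b) \<and>
     continuous_on integer_units \<omega>"

text \<open>For \<open>m > 0\<close> the units \<open>a\<close> with \<open>a - 1 \<in> ideal_power m\<close> form \<open>1 + \<pp>\<^sup>m\<close>; for \<open>m = 0\<close> they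
  are all units.\<close>

definition conductor_exponent :: "('a::nonarch_local_field \<Rightarrow> complex) \<Rightarrow> nat" where
  "conductor_exponent \<omega> =
     (LEAST m. \<forall>a \<in> integer_units. a - 1 \<in> ideal_power m \<longrightarrow> \<omega> a = 1)"

section \<open>The group of integral matrices and its subgroups\<close>

definition integral_matrices :: "('a::nonarch_local_field ^ 'n ^ 'k) set" where
  "integral_matrices = {A. \<forall>i j. A $ i $ j \<in> integers}"

definition GL_integers :: "('a::nonarch_local_field ^ 'n ^ 'n) set" where
  "GL_integers =
     {A \<in> integral_matrices. \<exists>B \<in> integral_matrices. A ** B = mat 1 \<and> B ** A = mat 1}"

definition congruence_subgroup :: "nat \<Rightarrow> ('a::nonarch_local_field ^ 'n ^ 'n) set" where
  "congruence_subgroup m = {k \<in> GL_integers. \<forall>i j. (k - mat 1) $ i $ j \<in> ideal_power m}"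

text \<open>From here on the coordinates \<open>1, \<dots>, n\<close> with \<open>n \<ge> 2\<close> are indexed by \<open>'m option\<close>, where
  \<open>CARD('m) = n - 1\<close>: \<open>Some i\<close> for the first \<open>n - 1\<close> coordinates and \<open>None\<close> for the last one.\<close>

definition block_matrix ::
    "'a::nonarch_local_field ^ 'm ^ 'm \<Rightarrow> 'a ^ 'm \<Rightarrow> 'a ^ ('m option) ^ ('m option)" where
  "block_matrix a b = (\<chi> i j.
     case i of
       Some i' \<Rightarrow> (case j of Some j' \<Rightarrow> a $ i' $ j' | None \<Rightarrow> b $ i')
     | None \<Rightarrow> (case j of Some _ \<Rightarrow> 0 | None \<Rightarrow> 1))"

definition mirabolic :: "('a::nonarch_local_field ^ ('m::finite option) ^ ('m option)) set" where
  "mirabolic =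
     {block_matrix a b | a b. a \<in> GL_integers \<and> (\<forall>i. b $ i \<in> integers)} \<inter> GL_integers"

definition e_last :: "'a::nonarch_local_field ^ ('m::finite option)" where
  "e_last = axis None 1"

text \<open>On a compact metrisable group every finite Borel measure is regular, so the Haar probability
  measure is the left-invariant Borel probability measure.\<close>

definition haar_probability :: "('a::nonarch_local_field ^ 'n ^ 'n) measure \<Rightarrow> bool" where
  "haar_probability M \<longleftrightarrow>
     prob_space M \<and> sets M = sets (restrict_space borel GL_integers) \<and>
     (\<forall>k \<in> GL_integers. \<forall>A \<in> sets M. emeasure M ((\<lambda>g. k ** g) ` A) = emeasure M A)"

section \<open>Functions on the unit sphere\<close>

definition unit_sphere :: "('a::nonarch_local_field ^ 'n) set" where
  "unit_sphere = {x. Max (range (\<lambda>i. absval (x $ i))) = 1}"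

text \<open>A function on the sphere is represented by its extension by zero to the whole space.\<close>

definition smooth_functions :: "('a::nonarch_local_field ^ 'n \<Rightarrow> complex) set" where
  "smooth_functions =
     {f. (\<forall>x \<in> unit_sphere. \<exists>U. open U \<and> x \<in> U \<and> (\<forall>y \<in> unit_sphere \<inter> U. f y = f x)) \<and>
         (\<forall>x. x \<notin> unit_sphere \<longrightarrow> f x = 0)}"

definition sphere_inner ::
    "('a::nonarch_local_field ^ ('m::finite option) ^ ('m option)) measure \<Rightarrow>
     ('a ^ ('m option) \<Rightarrow> complex) \<Rightarrow> ('a ^ ('m option) \<Rightarrow> complex) \<Rightarrow> complex" where
  "sphere_inner M f g = (LINT k|M. f (e_last v* k) * cnj (g (e_last v* k)))"

definition level_space ::
    "('a::nonarch_local_field \<Rightarrow> complex) \<Rightarrow> nat \<Rightarrow> ('a ^ 'n \<Rightarrow> complex) set" where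
  "level_space \<omega> m =
     {f \<in> smooth_functions.
        (\<forall>k \<in> congruence_subgroup m. \<forall>x \<in> unit_sphere. f (x v* k) = f x) \<and>
        (\<forall>a \<in> integer_units. \<forall>x \<in> unit_sphere. f (a *s x) = \<omega> a * f x)}"

text \<open>Only meaningful for \<open>conductor_exponent \<omega> \<le> m\<close>.\<close>

definition harmonic_space ::
    "('a::nonarch_local_field ^ ('m::finite option) ^ ('m option)) measure \<Rightarrow>
     ('a \<Rightarrow> complex) \<Rightarrow> nat \<Rightarrow> ('a ^ ('m option) \<Rightarrow> complex) set" where
  "harmonic_space M \<omega> m =
     (if m = conductor_exponent \<omega> then level_space \<omega> m
      else {f \<in> level_space \<omega> m. \<forall>g \<in> level_space \<omega> (m - 1). sphere_inner M f g = 0})"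

definition zonal_spherical ::
    "('a::nonarch_local_field ^ ('m::finite option) ^ ('m option)) measure \<Rightarrow>
     ('a \<Rightarrow> complex) \<Rightarrow> nat \<Rightarrow> ('a ^ ('m option) \<Rightarrow> complex)" where
  "zonal_spherical M \<omega> m =
     (THE P. P \<in> harmonic_space M \<omega> m \<and>
        (\<forall>x \<in> unit_sphere. \<forall>k \<in> mirabolic. P (x v* k) = P x) \<and> P e_last = 1)"

section \<open>Dimension and orthonormal bases\<close>

definition fun_scale :: "complex \<Rightarrow> ('b \<Rightarrow> complex) \<Rightarrow> ('b \<Rightarrow> complex)" where
  "fun_scale c f = (\<lambda>x. c * f x)"

interpretation cfun: vector_space "fun_scale :: complex \<Rightarrow> ('b \<Rightarrow> complex) \<Rightarrow> ('b \<Rightarrow> complex)"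
  by unfold_locales (auto simp: fun_scale_def algebra_simps)

definition orthonormal_basis ::
    "('a::nonarch_local_field ^ ('m::finite option) ^ ('m option)) measure \<Rightarrow>
     ('a ^ ('m option) \<Rightarrow> complex) set \<Rightarrow> (nat \<Rightarrow> ('a ^ ('m option) \<Rightarrow> complex)) \<Rightarrow> bool" where
  "orthonormal_basis M V Q \<longleftrightarrow>
     (\<forall>i \<in> {1..cfun.dim V}. \<forall>j \<in> {1..cfun.dim V}.
        sphere_inner M (Q i) (Q j) = (if i = j then 1 else 0)) \<and>
     cfun.span (Q ` {1..cfun.dim V}) = V"

end

theory Submission
  imports Defs
begin

text \<open>For an orthonormal basis the kernel \<open>Z x y = (\<Sum>j. Q j x * cnj (Q j y))\<close> satisfies
  \<open>Z (x v* k) y = Z x (y v* matrix_inv k)\<close>, because the harmonic space and its inner product are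
  invariant under translation by \<open>GL_integers\<close>.  Hence the left-hand side is
  \<open>Z (x v* matrix_inv k) e_last\<close>, and \<open>Z _ e_last\<close> is mirabolic invariant with value
  \<open>dim\<close> at \<open>e_last\<close>.  It remains to see that a mirabolic invariant harmonic function is determined by
  its value at \<open>e_last\<close>.  An orbit of the mirabolic group is described by the size of the first
  coordinates and the residue of the last coordinate modulo that size, so such a function of level
  \<open>m\<close> vanishing at \<open>e_last\<close> vanishes wherever the first coordinates lie in \<open>\<pp>\<^sup>m\<close>.  At the
  conductor, equivariance under \<open>1 + \<pp>\<^sup>m\<^sup>-\<^sup>1\<close> makes it vanish elsewhere; above it,
  orthogonality to a function of level \<open>m - 1\<close> makes its norm zero.\<close>

section \<open>The absolute value\<close>

lemma absval_0 [simp]: "absval (0::'a::nonarch_field) = 0"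
  using dist_absval[of "0::'a" 0] by simp

lemma absval_eq_0_iff [simp]: "absval (x::'a::nonarch_field) = 0 \<longleftrightarrow> x = 0"
  by (metis dist_absval diff_zero dist_eq_0_iff)

lemma absval_nonneg [simp]: "0 \<le> absval (x::'a::nonarch_field)"
  by (metis dist_absval diff_zero zero_le_dist)

lemma absval_pos_iff [simp]: "0 < absval (x::'a::nonarch_field) \<longleftrightarrow> x \<noteq> 0"
  by (metis absval_eq_0_iff absval_nonneg order_le_less less_irrefl)

lemma absval_1 [simp]: "absval (1::'a::nonarch_field) = 1"
proof -
  have "absval (1::'a) * absval (1::'a) = absval (1::'a)"
    by (metis absval_times mult_1)
  moreover have "absval (1::'a) \<noteq> 0"
    by simp
  ultimately show ?thesis
    by simp
qed

lemma absval_minus_commute: "absval (x - y) = absval (y - x :: 'a::nonarch_field)"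
  by (metis dist_absval dist_commute)

lemma absval_minus [simp]: "absval (- x) = absval (x :: 'a::nonarch_field)"
  using absval_minus_commute[of 0 x] by simp

lemma absval_inverse: "absval (inverse x) = inverse (absval (x :: 'a::nonarch_field))"
proof (cases "x = 0")
  case False
  then have "absval x * absval (inverse x) = 1"
    by (metis absval_times absval_1 right_inverse)
  then show ?thesis
    by (metis inverse_unique)
qed simp

lemma absval_divide: "absval (x / y) = absval x / absval y"
  by (simp add: divide_inverse absval_times absval_inverse)

lemma absval_power: "absval (x ^ m) = absval x ^ m"
  by (induction m) (simp_all add: absval_times)

lemma absval_add_le: "absval x \<le> r \<Longrightarrow> absval y \<le> r \<Longrightarrow> absval (x + y) \<le> r"
  using absval_plus_le_max[of x y] by simp

lemma absval_diff_le: "absval x \<le> r \<Longrightarrow> absval y \<le> r \<Longrightarrow> absval (x - y) \<le> r"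
  using absval_add_le[of x r "- y"] by simp

lemma absval_mult_le: "absval x \<le> 1 \<Longrightarrow> absval y \<le> r \<Longrightarrow> absval (x * y) \<le> r"
  using mult_mono[of "absval x" 1 "absval y" r] by (simp add: absval_times)

text \<open>The isosceles property of ultrametrics: a strictly smaller perturbation cannot change
  the size. It preserves the size of a pivot coordinate when a vector is perturbed.\<close>

lemma absval_eq_if_near:
  assumes "absval (y - x) < absval x"
  shows "absval y = absval x"
proof (rule antisym)
  show "absval y \<le> absval x"
    using absval_plus_le_max[of x "y - x"] assms by simp
  have "absval x \<le> max (absval y) (absval (y - x))"
    using absval_plus_le_max[of y "x - y"] by (simp add: absval_minus_commute)
  then show "absval x \<le> absval y"
    using assms by auto
qed

lemma integers_iff: "x \<in> integers \<longleftrightarrow> absval x \<le> 1"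
  by (simp add: integers_def)

lemma integer_units_iff: "(a::'a::nonarch_local_field) \<in> integer_units \<longleftrightarrow> absval a = 1"
proof
  assume "a \<in> integer_units"
  then obtain b where ab: "absval a \<le> 1" "absval b \<le> 1" "a * b = 1"
    by (auto simp: integer_units_def integers_iff)
  have "absval a * absval b = 1"
    using arg_cong[OF ab(3), of absval] by (simp add: absval_times)
  moreover have "absval a * absval b \<le> absval a * 1"
    using ab(2) by (intro mult_left_mono) simp_all
  ultimately show "absval a = 1"
    using ab(1) by simp
next
  assume a: "absval a = 1"
  then have "a \<noteq> 0"
    by auto
  then show "a \<in> integer_units"
    using a by (auto simp: integer_units_def integers_iff absval_inverse intro!: bexI[of _ "inverse a"])
qed

section \<open>Powers of the maximal ideal\<close>

lemma uniformiser_absval: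
  fixes w :: "'a::nonarch_local_field"
  assumes "uniformiser w"
  shows "0 < absval w" and "absval w < 1"
proof -
  show "0 < absval w"
    using assms by (simp add: uniformiser_def)
  have "w * 1 \<in> maximal_ideal"
    using assms unfolding uniformiser_def by (auto simp: integers_iff intro!: exI[of _ 1])
  then show "absval w < 1"
    by (simp add: maximal_ideal_def)
qed

text \<open>The value group is discrete: after division by \<open>w ^ m\<close> the element lies in
  the maximal ideal, so another factor \<open>w\<close> splits off.\<close>

lemma uniformiser_discrete:
  fixes w :: "'a::nonarch_local_field"
  assumes w: "uniformiser w" and x: "absval (x::'a) < absval w ^ m"
  shows "absval x \<le> absval w ^ Suc m"
proof -
  have "0 < absval w ^ m"
    using uniformiser_absval(1)[OF w] by simp
  then have "absval (x / w ^ m) < 1"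
    using x by (simp add: absval_divide absval_power)
  then have "x / w ^ m \<in> maximal_ideal"
    by (simp add: maximal_ideal_def)
  then obtain a where a: "x / w ^ m = w * a" "absval a \<le> 1"
    using w by (auto simp: uniformiser_def integers_iff)
  have "x = w ^ Suc m * a"
    using a(1) w by (simp add: uniformiser_def field_simps)
  then show ?thesis
    using a(2) by (simp add: absval_times absval_power mult_left_le)
qed

text \<open>The normalisation gives all uniformisers the same absolute value, so the choice of
  \<open>w\<close> in \<open>ideal_power\<close> does not matter and ideal arithmetic becomes
  ultrametric estimates.\<close>

lemma ideal_power_iff:
  fixes w x :: "'a::nonarch_local_field"
  assumes w: "uniformiser w"
  shows "x \<in> ideal_power m \<longleftrightarrow> absval x \<le> absval w ^ m"
proof
  assume "x \<in> ideal_power m"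
  then obtain v a where v: "uniformiser v" "absval a \<le> 1" "x = v ^ m * a"
    by (auto simp: ideal_power_def integers_iff)
  have "absval v = absval w"
    using absval_uniformiser[OF v(1)] absval_uniformiser[OF w] by simp
  then show "absval x \<le> absval w ^ m"
    using v by (simp add: absval_times absval_power mult_left_le)
next
  assume x: "absval x \<le> absval w ^ m"
  have w0: "w \<noteq> 0"
    using w by (simp add: uniformiser_def)
  then have "absval (x / w ^ m) \<le> 1"
    using x by (simp add: absval_divide absval_power)
  moreover have "x = w ^ m * (x / w ^ m)"
    using w0 by simp
  ultimately show "x \<in> ideal_power m"
    using w unfolding ideal_power_def integers_iff by blast
qed

lemma ideal_power_iff_absval_le:
  fixes x :: "'a::nonarch_local_field"
  shows "x \<in> ideal_power m \<longleftrightarrow> absval x \<le> inverse (real (card (residue_field :: 'a set set))) ^ m"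
proof -
  obtain w :: 'a where "uniformiser w"
    using uniformiser_exists by blast
  then show ?thesis
    using ideal_power_iff absval_uniformiser by metis
qed

lemma ideal_power_generator:
  obtains t :: "'a::nonarch_local_field"
  where "t \<noteq> 0" and "\<And>x::'a. x \<in> ideal_power m \<longleftrightarrow> absval x \<le> absval t"
proof -
  obtain w :: 'a where w: "uniformiser w"
    using uniformiser_exists by blast
  show thesis
  proof
    show "w ^ m \<noteq> 0"
      using w by (simp add: uniformiser_def)
    show "x \<in> ideal_power m \<longleftrightarrow> absval x \<le> absval (w ^ m)" for x :: 'a
      using ideal_power_iff[OF w] by (simp add: absval_power)
  qed
qed

lemma ideal_power_0 [simp]: "ideal_power 0 = (integers :: 'a::nonarch_local_field set)"
  by (auto simp: ideal_power_iff_absval_le integers_iff)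

lemma ideal_power_zero [simp]: "0 \<in> ideal_power m"
  by (simp add: ideal_power_iff_absval_le)

lemma ideal_power_minus [simp]: "- x \<in> ideal_power m \<longleftrightarrow> x \<in> ideal_power m"
  by (simp add: ideal_power_iff_absval_le)

lemma ideal_power_add: "x \<in> ideal_power m \<Longrightarrow> y \<in> ideal_power m \<Longrightarrow> x + y \<in> ideal_power m"
  by (simp add: ideal_power_iff_absval_le absval_add_le)

lemma ideal_power_mult: "absval a \<le> 1 \<Longrightarrow> x \<in> ideal_power m \<Longrightarrow> a * x \<in> ideal_power m"
  by (simp add: ideal_power_iff_absval_le absval_mult_le)

lemma ideal_power_sum:
  "(\<And>i. i \<in> I \<Longrightarrow> f i \<in> ideal_power m) \<Longrightarrow> (\<Sum>i\<in>I. f i) \<in> ideal_power m"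
  by (induction I rule: infinite_finite_induct) (auto intro: ideal_power_add)

lemma ideal_power_mono:
  fixes x :: "'a::nonarch_local_field"
  assumes "x \<in> ideal_power n" and "m \<le> n"
  shows "x \<in> ideal_power m"
proof -
  obtain w :: 'a where w: "uniformiser w"
    using uniformiser_exists by blast
  have "absval w ^ n \<le> absval w ^ m"
    using uniformiser_absval[OF w] assms(2) by (intro power_decreasing) simp_all
  then show ?thesis
    using assms(1) by (simp add: ideal_power_iff[OF w])
qed

lemma ideal_power_le_1: "x \<in> ideal_power m \<Longrightarrow> absval x \<le> 1"
  using ideal_power_mono[of x m 0] by (simp add: integers_iff)

lemma ideal_power_less_1:
  fixes x :: "'a::nonarch_local_field"
  assumes "x \<in> ideal_power m" and "0 < m"
  shows "absval x < 1"
proof -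
  obtain w :: 'a where w: "uniformiser w"
    using uniformiser_exists by blast
  have "x \<in> ideal_power 1"
    using ideal_power_mono[OF assms(1), of 1] assms(2) by simp
  then show ?thesis
    using uniformiser_absval(2)[OF w] by (simp add: ideal_power_iff[OF w])
qed

text \<open>No absolute value lies strictly between those of \<open>w ^ m\<close> and
  \<open>w ^ (m - 1)\<close>. This gap drives both vanishing arguments for mirabolic invariant
  functions.\<close>

lemma ideal_power_discrete:
  fixes x y :: "'a::nonarch_local_field"
  assumes "x \<notin> ideal_power m" and "y \<in> ideal_power (m - 1)" and "0 < m"
  shows "absval y \<le> absval x"
proof -
  obtain w :: 'a where w: "uniformiser w"
    using uniformiser_exists by blast
  have "\<not> absval x < absval w ^ (m - 1)"
    using uniformiser_discrete[OF w, of x "m - 1"] assms(1,3) by (auto simp: ideal_power_iff[OF w])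
  then show ?thesis
    using assms(2) by (simp add: ideal_power_iff[OF w])
qed

text \<open>Truncated expansions in powers of a uniformiser, with one digit per residue class, meet
  every class.\<close>

lemma finite_representatives:
  obtains R :: "'a::nonarch_local_field set"
  where "finite R" and "\<And>x::'a. absval x \<le> 1 \<Longrightarrow> \<exists>r\<in>R. x - r \<in> ideal_power m"
proof -
  obtain w :: 'a where w: "uniformiser w"
    using uniformiser_exists by blast
  define E where "E = {(x::'a, y). x \<in> integers \<and> y \<in> integers \<and> x - y \<in> maximal_ideal}"
  define S where "S = (\<lambda>C. SOME r. r \<in> C) ` (residue_field :: 'a set set)"
  have fin: "finite S"
    unfolding S_def using finite_residue_field by (rule finite_imageI)
  have rep: "\<exists>r\<in>S. \<exists>a. x - r = w * a \<and> absval a \<le> 1" if "absval x \<le> 1" for x :: 'a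
  proof -
    have "E `` {x} \<in> residue_field"
      using that unfolding residue_field_def E_def quotient_def by (auto simp: integers_iff)
    then have "(SOME r. r \<in> E `` {x}) \<in> S"
      unfolding S_def by (rule imageI)
    moreover have "x \<in> E `` {x}"
      using that by (auto simp: E_def integers_iff maximal_ideal_def)
    then have "(SOME r. r \<in> E `` {x}) \<in> E `` {x}"
      by (rule someI)
    then have "x - (SOME r. r \<in> E `` {x}) \<in> maximal_ideal"
      unfolding E_def by blast
    then have "\<exists>a. x - (SOME r. r \<in> E `` {x}) = w * a \<and> absval a \<le> 1"
      using w by (auto simp: uniformiser_def integers_iff)
    ultimately show ?thesis
      by blast
  qed
  have "\<exists>R. finite R \<and> (\<forall>x::'a. absval x \<le> 1 \<longrightarrow> (\<exists>r\<in>R. x - r \<in> ideal_power m))"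
  proof (induction m)
    case 0
    show ?case
      by (intro exI[of _ "{0}"]) (simp add: integers_iff)
  next
    case (Suc m)
    then obtain R where R: "finite R" "\<And>x::'a. absval x \<le> 1 \<Longrightarrow> \<exists>r\<in>R. x - r \<in> ideal_power m"
      by blast
    \<comment> \<open>A leading digit \<open>s\<close> plus \<open>w\<close> times a representative
      of the remainder modulo the previous power.\<close>
    show ?case
    proof (intro exI[of _ "(\<lambda>(s, r). s + w * r) ` (S \<times> R)"] conjI allI impI)
      show "finite ((\<lambda>(s, r). s + w * r) ` (S \<times> R))"
        using fin R(1) by simp
      fix x :: 'a
      assume "absval x \<le> 1"
      then obtain s a where s: "s \<in> S" "x - s = w * a" "absval a \<le> 1"
        using rep by blast
      obtain r where r: "r \<in> R" "a - r \<in> ideal_power m"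
        using R(2) s(3) by blast
      have "x - (s + w * r) = w * (a - r)"
        using s(2) by (simp add: algebra_simps)
      then have "absval (x - (s + w * r)) = absval w * absval (a - r)"
        by (simp only: absval_times)
      then have "x - (s + w * r) \<in> ideal_power (Suc m)"
        using r(2) uniformiser_absval(1)[OF w] by (simp add: ideal_power_iff[OF w])
      then show "\<exists>r\<in>(\<lambda>(s, r). s + w * r) ` (S \<times> R). x - r \<in> ideal_power (Suc m)"
        using s(1) r(1) by force
    qed
  qed
  then show thesis
    using that by blast
qed

lemma less_1_imp_ideal_power:
  fixes x :: "'a::nonarch_local_field"
  assumes "absval x < 1"
  shows "x \<in> ideal_power 1"
  using ideal_power_discrete[of x 1 1] assms by (auto simp: integers_iff)

text \<open>By the ultrametric inequality, the ball of radius \<open>absval t\<close> around any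
  point of the coset stays inside it.\<close>

lemma open_ideal_power_coset:
  "open {a. a - b \<in> ideal_power m}" for b :: "'a::nonarch_local_field"
proof -
  obtain t :: 'a where t: "t \<noteq> 0" "\<And>x::'a. x \<in> ideal_power m \<longleftrightarrow> absval x \<le> absval t"
    by (rule ideal_power_generator[of m, where 'a='a]) blast
  show ?thesis
    unfolding open_dist
  proof (intro ballI exI conjI allI impI)
    show "0 < absval t"
      using t(1) by simp
    fix a a' :: 'a
    assume "a \<in> {a. a - b \<in> ideal_power m}" and "dist a' a < absval t"
    then have "(a' - a) + (a - b) \<in> ideal_power m"
      by (intro ideal_power_add) (auto simp: t(2) dist_absval)
    then show "a' \<in> {a. a - b \<in> ideal_power m}"
      by simp
  qed
qed

section \<open>Integral matrices and congruences\<close>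

text \<open>On the unit sphere the classes of this relation are the orbits of
  \<open>congruence_subgroup m\<close>, so invariance under that group can be tested
  coordinatewise.\<close>

definition vec_cong :: "nat \<Rightarrow> 'a::nonarch_local_field ^ 'n \<Rightarrow> 'a ^ 'n \<Rightarrow> bool" where
  "vec_cong m x y \<longleftrightarrow> (\<forall>i. x $ i - y $ i \<in> ideal_power m)"

definition mat_cong :: "nat \<Rightarrow> 'a::nonarch_local_field ^ 'n ^ 'k \<Rightarrow> 'a ^ 'n ^ 'k \<Rightarrow> bool" where
  "mat_cong m A B \<longleftrightarrow> (\<forall>i. vec_cong m (A $ i) (B $ i))"

lemma vec_cong_refl [simp]: "vec_cong m x x"
  by (simp add: vec_cong_def)

lemma vec_cong_sym:
  assumes "vec_cong m x y"
  shows "vec_cong m y x"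
  unfolding vec_cong_def
proof
  fix i
  have "- (x $ i - y $ i) \<in> ideal_power m"
    using assms unfolding vec_cong_def by (simp only: ideal_power_minus)
  then show "y $ i - x $ i \<in> ideal_power m"
    by simp
qed

lemma vec_cong_trans:
  assumes "vec_cong m x y" and "vec_cong m y z"
  shows "vec_cong m x z"
  unfolding vec_cong_def
proof
  fix i
  have "(x $ i - y $ i) + (y $ i - z $ i) \<in> ideal_power m"
    using assms unfolding vec_cong_def by (blast intro: ideal_power_add)
  then show "x $ i - z $ i \<in> ideal_power m"
    by simp
qed

lemma vec_cong_mono: "vec_cong n x y \<Longrightarrow> m \<le> n \<Longrightarrow> vec_cong m x y"
  unfolding vec_cong_def using ideal_power_mono by blast

lemma mat_cong_refl [simp]: "mat_cong m A A"
  by (simp add: mat_cong_def)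

lemma mat_cong_sym: "mat_cong m A B \<Longrightarrow> mat_cong m B A"
  by (simp add: mat_cong_def vec_cong_sym)

lemma mat_cong_trans: "mat_cong m A B \<Longrightarrow> mat_cong m B C \<Longrightarrow> mat_cong m A C"
  unfolding mat_cong_def using vec_cong_trans by metis

lemma integral_matrices_absval: "A \<in> integral_matrices \<Longrightarrow> absval (A $ i $ j) \<le> 1"
  by (simp add: integral_matrices_def integers_iff)

lemma vector_matrix_nth: "(x v* A) $ j = (\<Sum>i\<in>UNIV. A $ i $ j * x $ i)"
  for x :: "'a::comm_semiring_1 ^ 'k"
  by (simp add: vector_matrix_mult_def mult.commute)

lemma matrix_mult_row: "(A ** B) $ i = A $ i v* B"
  by (simp add: matrix_matrix_mult_def vector_matrix_mult_def vec_eq_iff)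

lemma ideal_power_vector_matrix:
  assumes "A \<in> integral_matrices" and "\<And>i. x $ i \<in> ideal_power m"
  shows "(x v* A) $ j \<in> ideal_power m"
  unfolding vector_matrix_nth
  using assms by (intro ideal_power_sum ideal_power_mult) (simp_all add: integral_matrices_absval)

lemma vec_cong_vector_matrix:
  assumes "A \<in> integral_matrices" and "vec_cong m x y"
  shows "vec_cong m (x v* A) (y v* A)"
proof -
  have "((x - y) v* A) $ j \<in> ideal_power m" for j
    using assms by (intro ideal_power_vector_matrix) (simp_all add: vec_cong_def)
  then show ?thesis
    by (simp add: vec_cong_def vector_matrix_nth right_diff_distrib sum_subtractf)
qed

lemma vec_cong_vector_matrix_left:
  assumes "mat_cong m A B" and "\<And>i. absval (x $ i) \<le> 1"
  shows "vec_cong m (x v* A) (x v* B)"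
proof -
  have "(x v* A) $ j - (x v* B) $ j = (\<Sum>i\<in>UNIV. x $ i * (A $ i $ j - B $ i $ j))" for j
    by (simp add: vector_matrix_nth sum_subtractf algebra_simps)
  then show ?thesis
    using assms unfolding vec_cong_def mat_cong_def
    by (auto intro!: ideal_power_sum ideal_power_mult)
qed

lemma mat_cong_mult_right:
  "C \<in> integral_matrices \<Longrightarrow> mat_cong m A B \<Longrightarrow> mat_cong m (A ** C) (B ** C)"
  by (simp add: mat_cong_def matrix_mult_row vec_cong_vector_matrix)

lemma mat_cong_mult_left:
  "C \<in> integral_matrices \<Longrightarrow> mat_cong m A B \<Longrightarrow> mat_cong m (C ** A) (C ** B)"
  by (subst mat_cong_def) (simp add: matrix_mult_row vec_cong_vector_matrix_left integral_matrices_absval)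

lemma open_vec_cong: "open {y. vec_cong m y (x :: 'a::nonarch_local_field ^ 'n)}"
proof -
  have "{y. vec_cong m y x} = (\<Inter>i. (\<lambda>y. y $ i) -` {a. a - x $ i \<in> ideal_power m})"
    by (auto simp: vec_cong_def)
  then show ?thesis
    by (simp only:) (intro open_INT finite ballI open_vimage_vec_nth open_ideal_power_coset)
qed

lemma open_mat_cong: "open {B. mat_cong m B (A :: 'a::nonarch_local_field ^ 'n ^ 'k)}"
proof -
  have "{B. mat_cong m B A} = (\<Inter>i. (\<lambda>B. B $ i) -` {y. vec_cong m y (A $ i)})"
    by (auto simp: mat_cong_def)
  then show ?thesis
    by (simp only:) (intro open_INT finite ballI open_vimage_vec_nth open_vec_cong)
qed

section \<open>Groups of integral matrices\<close>

lemma integral_matrices_mult: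
  assumes "A \<in> integral_matrices" and "B \<in> integral_matrices"
  shows "A ** B \<in> integral_matrices"
proof -
  have "(A ** B) $ i $ j \<in> ideal_power 0" for i j
    unfolding matrix_mult_row
    using assms by (intro ideal_power_vector_matrix) (simp_all add: integers_iff integral_matrices_absval)
  then show ?thesis
    by (simp add: integral_matrices_def)
qed

lemma GL_integers_integral: "A \<in> GL_integers \<Longrightarrow> A \<in> integral_matrices"
  by (simp add: GL_integers_def)

lemma GL_integers_mult:
  assumes "A \<in> GL_integers" and "B \<in> GL_integers"
  shows "A ** B \<in> GL_integers"
proof -
  obtain A' B' where
    A': "A' \<in> integral_matrices" "A ** A' = mat 1" "A' ** A = mat 1" and
    B': "B' \<in> integral_matrices" "B ** B' = mat 1" "B' ** B = mat 1"
    using assms unfolding GL_integers_def by blast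
  have "(A ** B) ** (B' ** A') = A ** (B ** B') ** A'"
    by (simp only: matrix_mul_assoc)
  moreover have "(B' ** A') ** (A ** B) = B' ** (A' ** A) ** B"
    by (simp only: matrix_mul_assoc)
  moreover have "A ** B \<in> integral_matrices" "B' ** A' \<in> integral_matrices"
    using assms A' B' by (simp_all add: integral_matrices_mult GL_integers_integral)
  ultimately show ?thesis
    using A' B' unfolding GL_integers_def by (auto intro!: bexI[of _ "B' ** A'"])
qed

text \<open>\<open>matrix_inv\<close> is a choice; uniqueness of two-sided inverses identifies it
  with the integral inverse \<open>B\<close> that membership in \<open>GL_integers\<close>
  provides.\<close>

lemma GL_integers_matrix_inv:
  assumes "k \<in> GL_integers"
  shows "matrix_inv k \<in> GL_integers" and "k ** matrix_inv k = mat 1" and "matrix_inv k ** k = mat 1"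
proof -
  obtain B where B: "B \<in> integral_matrices" "k ** B = mat 1" "B ** k = mat 1"
    using assms unfolding GL_integers_def by blast
  then have "\<exists>B. k ** B = mat 1 \<and> B ** k = mat 1"
    by blast
  then have inv: "k ** matrix_inv k = mat 1 \<and> matrix_inv k ** k = mat 1"
    unfolding matrix_inv_def by (rule someI_ex)
  have "matrix_inv k = B ** (k ** matrix_inv k)"
    by (simp only: matrix_mul_assoc B(3) matrix_mul_lid)
  then have eq: "matrix_inv k = B"
    using inv by simp
  have "B \<in> GL_integers"
    using B GL_integers_integral[OF assms] unfolding GL_integers_def by blast
  then show "matrix_inv k \<in> GL_integers"
    by (simp only: eq)
  show "k ** matrix_inv k = mat 1" "matrix_inv k ** k = mat 1"
    using inv by blast+
qed

section \<open>The unit sphere and the action on it\<close>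

lemma unit_sphere_iff:
  "x \<in> unit_sphere \<longleftrightarrow> (\<forall>i. absval (x $ i) \<le> 1) \<and> (\<exists>i. absval (x $ i) = 1)"
proof
  assume "x \<in> unit_sphere"
  then have M: "Max (range (\<lambda>i. absval (x $ i))) = 1"
    by (simp add: unit_sphere_def)
  moreover have "Max (range (\<lambda>i. absval (x $ i))) \<in> range (\<lambda>i. absval (x $ i))"
    by (rule Max_in) simp_all
  moreover have "absval (x $ i) \<le> Max (range (\<lambda>i. absval (x $ i)))" for i
    by (rule Max_ge) simp_all
  ultimately show "(\<forall>i. absval (x $ i) \<le> 1) \<and> (\<exists>i. absval (x $ i) = 1)"
    by (metis imageE)
next
  assume "(\<forall>i. absval (x $ i) \<le> 1) \<and> (\<exists>i. absval (x $ i) = 1)"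
  then show "x \<in> unit_sphere"
    unfolding unit_sphere_def by (auto intro!: Max_eqI)
qed

lemma unit_sphere_absval: "x \<in> unit_sphere \<Longrightarrow> absval (x $ i) \<le> 1"
  by (simp add: unit_sphere_iff)

text \<open>If all coordinates of the image lay in the maximal ideal, multiplying by the integral
  inverse would put all coordinates of \<open>x\<close> there as well.\<close>

lemma unit_sphere_vector_matrix:
  assumes k: "k \<in> GL_integers" and x: "x \<in> unit_sphere"
  shows "x v* k \<in> unit_sphere"
proof -
  have "(x v* k) $ i \<in> ideal_power 0" for i
    using k x by (intro ideal_power_vector_matrix)
      (simp_all add: GL_integers_integral integers_iff unit_sphere_absval)
  then have le: "absval ((x v* k) $ i) \<le> 1" for i
    by (simp add: integers_iff)
  have "\<exists>i. absval ((x v* k) $ i) = 1"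
  proof (rule ccontr)
    assume "\<nexists>i. absval ((x v* k) $ i) = 1"
    then have "(x v* k) $ i \<in> ideal_power 1" for i
      using le by (intro less_1_imp_ideal_power) (simp add: less_le)
    then have "((x v* k) v* matrix_inv k) $ i \<in> ideal_power 1" for i
      by (rule ideal_power_vector_matrix[OF GL_integers_integral[OF GL_integers_matrix_inv(1)[OF k]]])
    then have "x $ i \<in> ideal_power 1" for i
      by (simp only: vector_matrix_mul_assoc GL_integers_matrix_inv(2)[OF k] vector_matrix_mul_rid)
    then have "absval (x $ i) < 1" for i
      by (rule ideal_power_less_1) simp
    then show False
      using x unfolding unit_sphere_iff by (metis less_irrefl)
  qed
  then show ?thesis
    using le by (simp add: unit_sphere_iff)
qed

lemma vector_matrix_matrix_inv:
  assumes "k \<in> GL_integers"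
  shows "(x v* k) v* matrix_inv k = x" and "(x v* matrix_inv k) v* k = x"
  using GL_integers_matrix_inv(2,3)[OF assms]
  by (simp_all only: vector_matrix_mul_assoc vector_matrix_mul_rid)

lemma unit_sphere_vector_matrix_iff:
  assumes "k \<in> GL_integers"
  shows "x v* k \<in> unit_sphere \<longleftrightarrow> x \<in> unit_sphere"
proof
  assume "x v* k \<in> unit_sphere"
  then have "(x v* k) v* matrix_inv k \<in> unit_sphere"
    by (rule unit_sphere_vector_matrix[OF GL_integers_matrix_inv(1)[OF assms]])
  then show "x \<in> unit_sphere"
    by (simp only: vector_matrix_matrix_inv(1)[OF assms])
qed (rule unit_sphere_vector_matrix[OF assms])

lemma unit_sphere_scale: "a \<in> integer_units \<Longrightarrow> a *s x \<in> unit_sphere \<longleftrightarrow> x \<in> unit_sphere"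
  by (simp add: unit_sphere_iff integer_units_iff absval_times)

lemma e_last_nth: "e_last $ None = 1" "e_last $ Some i = 0"
  by (simp_all add: e_last_def axis_def)

lemma e_last_in_unit_sphere [simp]: "e_last \<in> unit_sphere"
proof -
  have "absval (e_last $ i) \<le> 1" for i :: "'b option"
    by (cases i) (simp_all add: e_last_nth)
  moreover have "absval (e_last $ None) = 1"
    by (simp add: e_last_nth)
  ultimately show ?thesis
    unfolding unit_sphere_iff by blast
qed

section \<open>Transitivity of the matrix groups\<close>

text \<open>Matrices \<open>1 + e\<^sub>i\<^sup>T v\<close>, which differ from the identity in the \<open>i\<close>-th row only, suffice for
  every transitivity statement below.\<close>

definition row_elementary :: "'n \<Rightarrow> 'a::nonarch_local_field ^ 'n \<Rightarrow> 'a ^ 'n ^ 'n" where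
  "row_elementary i v = (\<chi> r c. (if r = c then 1 else 0) + (if r = i then v $ c else 0))"

lemma row_elementary_row: "row_elementary i v $ r = axis r 1 + (if r = i then v else 0)"
  by (simp add: row_elementary_def vec_eq_iff axis_def eq_commute)

lemma vector_matrix_row_elementary: "x v* row_elementary i v = x + x $ i *s v"
  unfolding vec_eq_iff vector_matrix_nth row_elementary_def
  by (simp add: distrib_right sum.distrib if_distrib[of "\<lambda>z. z * _"] cong: if_cong)

text \<open>Matrices altered in one fixed row are closed under products, so inverting one amounts to
  solving a vector equation.\<close>

lemma row_elementary_mult:
  "row_elementary i u ** row_elementary i v = row_elementary i (u + v + u $ i *s v)"
  unfolding vec_eq_iff[of "row_elementary i u ** row_elementary i v"] matrix_mult_row
    vector_matrix_row_elementary row_elementary_row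
  by (simp add: vec_eq_iff axis_def algebra_simps)

lemma row_elementary_0: "row_elementary i 0 = mat 1"
  by (simp add: row_elementary_def mat_def vec_eq_iff)

lemma row_elementary_integral:
  assumes "\<And>c. absval (v $ c) \<le> 1"
  shows "row_elementary i v \<in> integral_matrices"
  using assms by (auto simp: integral_matrices_def row_elementary_def integers_iff intro!: absval_add_le)

text \<open>The determinant is \<open>1 + v $ i\<close>; dividing by this unit gives an inverse of
  the same shape, with \<open>u\<close> proportional to \<open>v\<close>.\<close>

lemma row_elementary_GL:
  assumes v: "\<And>c. absval (v $ c) \<le> 1" and unit: "absval (1 + v $ i) = 1"
  shows "row_elementary i v \<in> GL_integers"
proof -
  define d where "d = inverse (1 + v $ i)"
  define u where "u = - d *s v"
  have "1 + v $ i \<noteq> 0"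
    using unit by auto
  then have d: "d + v $ i * d = 1"
    unfolding d_def by (metis distrib_right mult_1 right_inverse)
  have "v + u + v $ i *s u = (1 - (d + v $ i * d)) *s v" "u + v + u $ i *s v = (1 - (d + v $ i * d)) *s v"
    by (simp_all add: u_def vec_eq_iff algebra_simps)
  then have eq: "v + u + v $ i *s u = 0" "u + v + u $ i *s v = 0"
    by (simp_all add: d)
  have "row_elementary i u \<in> integral_matrices"
    using v unit by (intro row_elementary_integral) (simp add: u_def d_def absval_times absval_inverse)
  moreover have "row_elementary i v ** row_elementary i u = mat 1"
    "row_elementary i u ** row_elementary i v = mat 1"
    by (simp_all only: row_elementary_mult eq row_elementary_0)
  moreover have "row_elementary i v \<in> integral_matrices"
    using v by (rule row_elementary_integral)
  ultimately show ?thesis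
    unfolding GL_integers_def by blast
qed

text \<open>Altering one of the first rows leaves the last row intact: the block \<open>a\<close> is
  again altered in one row, and \<open>b\<close> is supported at \<open>i\<close>.\<close>

lemma row_elementary_mirabolic:
  assumes v: "\<And>c. absval (v $ c) \<le> 1" and unit: "absval (1 + v $ Some i) = 1"
  shows "row_elementary (Some i) v \<in> mirabolic"
proof -
  let ?a = "row_elementary i (\<chi> c. v $ Some c)" and ?b = "axis i (v $ None)"
  have "row_elementary (Some i) v = block_matrix ?a ?b"
    by (auto simp: vec_eq_iff row_elementary_def block_matrix_def axis_def split: option.splits)
  moreover have "?a \<in> GL_integers"
    using v unit by (intro row_elementary_GL) simp_all
  moreover have "?b $ r \<in> integers" for r
    using v by (simp add: axis_def integers_iff)
  moreover have "row_elementary (Some i) v \<in> GL_integers"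
    using v unit by (rule row_elementary_GL)
  ultimately show ?thesis
    unfolding mirabolic_def by blast
qed

text \<open>The equation \<open>x + x $ i *s v = y\<close> determines \<open>v\<close>. The bound on
  the differences makes \<open>v\<close> integral, and equal sizes at \<open>i\<close> make
  \<open>1 + v $ i = y $ i / x $ i\<close> a unit.\<close>

lemma row_elementary_transport:
  fixes x y :: "'a::nonarch_local_field ^ 'n"
  assumes "x $ i \<noteq> 0" and "absval (y $ i) = absval (x $ i)"
    and "\<And>l. absval (y $ l - x $ l) \<le> absval (x $ i)"
  defines "v \<equiv> \<chi> l. (y $ l - x $ l) / x $ i"
  shows "absval (v $ l) \<le> 1" and "absval (1 + v $ i) = 1" and "x v* row_elementary i v = y"
proof -
  have pos: "0 < absval (x $ i)"
    using assms(1) by simp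
  show "absval (v $ l) \<le> 1"
    using assms(3)[of l] pos by (simp add: v_def absval_divide)
  have "1 + v $ i = y $ i / x $ i"
    using assms(1) by (simp add: v_def field_simps)
  then show "absval (1 + v $ i) = 1"
    using assms(2) pos by (simp add: absval_divide)
  show "x v* row_elementary i v = y"
    using assms(1) by (simp add: vector_matrix_row_elementary vec_eq_iff v_def)
qed

text \<open>One altered row needs a common pivot position in \<open>x\<close> and \<open>y\<close>;
  two rows suffice when the pivots \<open>i\<close> and \<open>j\<close> differ.\<close>

lemma two_step_transport:
  fixes x y :: "'a::nonarch_local_field ^ 'n"
  assumes i: "x $ i \<noteq> 0" and ij: "absval (y $ j) = absval (x $ i)"
    and near: "\<And>l. absval (y $ l - x $ l) \<le> absval (x $ i)"
  obtains u v where "\<And>l. absval (u $ l) \<le> 1" "absval (1 + u $ i) = 1"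
    "\<And>l. absval (v $ l) \<le> 1" "absval (1 + v $ j) = 1"
    "x v* row_elementary i u v* row_elementary j v = y"
proof -
  \<comment> \<open>\<open>z\<close> is \<open>x\<close> with coordinate \<open>j\<close> already
    corrected: coordinate \<open>i\<close> keeps the size needed for the first move, and coordinate
    \<open>j\<close> is a pivot for the second.\<close>
  define z where "z = (\<chi> l. if l = j then y $ j else x $ l)"
  define u where "u = (\<chi> l. (z $ l - x $ l) / x $ i)"
  define v where "v = (\<chi> l. (y $ l - z $ l) / z $ j)"
  have y0: "y $ j \<noteq> 0"
    using i ij by (metis absval_eq_0_iff)
  have zi: "absval (z $ i) = absval (x $ i)"
    using ij by (simp add: z_def)
  have xz: "absval (z $ l - x $ l) \<le> absval (x $ i)" for l
    using near by (simp add: z_def)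
  have zj: "z $ j \<noteq> 0" "absval (y $ j) = absval (z $ j)"
    using y0 by (simp_all add: z_def)
  have zy: "absval (y $ l - z $ l) \<le> absval (z $ j)" for l
    using near ij by (simp add: z_def)
  show thesis
    using that[of u v]
      row_elementary_transport[of x i z, OF i zi xz, folded u_def]
      row_elementary_transport[of z j y, OF zj zy, folded v_def] by metis
qed

section \<open>Transitivity on the sphere and on congruence classes\<close>

lemma GL_transitive:
  assumes "x \<in> unit_sphere" and "y \<in> unit_sphere"
  shows "\<exists>k\<in>GL_integers. x v* k = y"
proof -
  obtain i j where ij: "absval (x $ i) = 1" "absval (y $ j) = 1"
    using assms unfolding unit_sphere_iff by blast
  have "x $ i \<noteq> 0"
    using ij by auto
  moreover have "absval (y $ l - x $ l) \<le> absval (x $ i)" for l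
    using assms ij by (auto intro!: absval_diff_le simp: unit_sphere_absval)
  ultimately obtain u v where uv: "\<And>l. absval (u $ l) \<le> 1" "absval (1 + u $ i) = 1"
    "\<And>l. absval (v $ l) \<le> 1" "absval (1 + v $ j) = 1"
    "x v* row_elementary i u v* row_elementary j v = y"
    using two_step_transport[of x i y j] ij by metis
  then show ?thesis
    by (intro bexI[of _ "row_elementary i u ** row_elementary j v"])
      (simp_all add: vector_matrix_mul_assoc GL_integers_mult row_elementary_GL)
qed

lemma e_last_orbit: "x \<in> unit_sphere \<Longrightarrow> \<exists>k\<in>GL_integers. x = e_last v* k"
  using GL_transitive[OF e_last_in_unit_sphere] by metis

text \<open>At level \<open>0\<close> the subgroup is all of \<open>GL_integers\<close>. At positive
  level a unit coordinate of \<open>x\<close> stays a unit in \<open>y\<close>, so one altered row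
  suffices, and \<open>v\<close> inherits the congruence.\<close>

lemma congruence_subgroup_transitive:
  assumes x: "x \<in> unit_sphere" and y: "y \<in> unit_sphere" and xy: "vec_cong m y x"
  shows "\<exists>k\<in>congruence_subgroup m. x v* k = y"
proof (cases "m = 0")
  case True
  have "k \<in> congruence_subgroup m" if "k \<in> GL_integers" for k :: "'a ^ 'b ^ 'b"
  proof -
    have "absval (k $ i $ j - mat 1 $ i $ j) \<le> 1" for i j
      using that by (intro absval_diff_le) (simp_all add: mat_def integral_matrices_absval GL_integers_integral)
    then show ?thesis
      using that True by (simp add: congruence_subgroup_def integers_iff)
  qed
  then show ?thesis
    using GL_transitive[OF x y] by blast
next
  case False
  obtain i where i: "absval (x $ i) = 1"
    using x unfolding unit_sphere_iff by blast
  have diff: "y $ l - x $ l \<in> ideal_power m" for l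
    using xy by (simp add: vec_cong_def)
  have near: "absval (y $ l - x $ l) \<le> absval (x $ i)" for l
    using ideal_power_le_1[OF diff] i by simp
  have "absval (y $ i) = absval (x $ i)"
    using ideal_power_less_1[OF diff] False i by (intro absval_eq_if_near) simp
  moreover have "x $ i \<noteq> 0"
    using i by auto
  moreover define v where "v = (\<chi> l. (y $ l - x $ l) / x $ i)"
  ultimately have v: "\<And>l. absval (v $ l) \<le> 1" "absval (1 + v $ i) = 1" "x v* row_elementary i v = y"
    using row_elementary_transport[of x i y, folded v_def] near by blast+
  have "v $ l \<in> ideal_power m" for l
    using diff[of l] i by (simp add: v_def ideal_power_iff_absval_le absval_divide)
  then have "row_elementary i v \<in> congruence_subgroup m"
    using row_elementary_GL[OF v(1,2)]
    by (simp add: congruence_subgroup_def row_elementary_def mat_def)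
  then show ?thesis
    using v(3) by blast
qed

text \<open>Matching the \<open>None\<close> coordinate only up to the size of the others is what the block \<open>b\<close> of a
  mirabolic matrix can achieve.\<close>

lemma mirabolic_invariant_eq:
  assumes inv: "\<And>x k. x \<in> unit_sphere \<Longrightarrow> k \<in> mirabolic \<Longrightarrow> f (x v* k) = f x"
    and x: "x \<in> unit_sphere"
    and i: "x $ Some i \<noteq> 0" and ij: "absval (y $ Some j) = absval (x $ Some i)"
    and near: "\<And>l. absval (y $ l - x $ l) \<le> absval (x $ Some i)"
  shows "f y = f x"
proof -
  obtain u v where uv: "\<And>l. absval (u $ l) \<le> 1" "absval (1 + u $ Some i) = 1"
    "\<And>l. absval (v $ l) \<le> 1" "absval (1 + v $ Some j) = 1"
    "x v* row_elementary (Some i) u v* row_elementary (Some j) v = y"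
    using two_step_transport[of x "Some i" y "Some j"] i ij near by metis
  have "x v* row_elementary (Some i) u \<in> unit_sphere"
    using x row_elementary_GL[OF uv(1,2)] by (simp add: unit_sphere_vector_matrix)
  then have "f y = f (x v* row_elementary (Some i) u)"
    using inv row_elementary_mirabolic[OF uv(3,4)] uv(5) by metis
  also have "\<dots> = f x"
    using inv x row_elementary_mirabolic[OF uv(1,2)] by blast
  finally show ?thesis .
qed

lemma mirabolic_GL: "k \<in> mirabolic \<Longrightarrow> k \<in> GL_integers"
  by (simp add: mirabolic_def)

lemma e_last_mirabolic:
  assumes "k \<in> mirabolic"
  shows "e_last v* k = e_last"
proof -
  obtain a b where k: "k = block_matrix a b"
    using assms unfolding mirabolic_def by blast
  have "(e_last v* k) $ j = k $ None $ j" for j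
    by (simp add: vector_matrix_nth e_last_def axis_def if_distrib cong: if_cong)
  then show ?thesis
    by (simp add: k vec_eq_iff block_matrix_def e_last_def axis_def split: option.split)
qed

section \<open>Haar integrals of functions modulo a congruence subgroup\<close>

text \<open>Such functions factor through the finite set of classes modulo
  \<open>\<pp>\<^sup>m\<close>, which turns their Haar integrals into finite averages.\<close>

definition mat_cong_invariant ::
    "nat \<Rightarrow> ('a::nonarch_local_field ^ 'n ^ 'n \<Rightarrow> complex) \<Rightarrow> bool" where
  "mat_cong_invariant m F \<longleftrightarrow>
     (\<forall>k \<in> GL_integers. \<forall>k' \<in> GL_integers. mat_cong m k k' \<longrightarrow> F k = F k')"

lemma mat_cong_invariantD:
  "mat_cong_invariant m F \<Longrightarrow> k \<in> GL_integers \<Longrightarrow> k' \<in> GL_integers \<Longrightarrow> mat_cong m k k' \<Longrightarrow> F k = F k'"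
  unfolding mat_cong_invariant_def by (drule bspec, assumption)+ (erule mp)

definition GL_representatives :: "nat \<Rightarrow> ('a::nonarch_local_field ^ 'n ^ 'n) set \<Rightarrow> bool" where
  "GL_representatives m R \<longleftrightarrow> finite R \<and> R \<subseteq> GL_integers \<and>
     (\<forall>k \<in> GL_integers. \<exists>r \<in> R. mat_cong m k r) \<and>
     (\<forall>r \<in> R. \<forall>r' \<in> R. mat_cong m r r' \<longrightarrow> r = r')"

lemma GL_representativesD:
  assumes "GL_representatives m R"
  shows "finite R" and "R \<subseteq> GL_integers"
    and "\<And>k. k \<in> GL_integers \<Longrightarrow> \<exists>r\<in>R. mat_cong m k r"
    and "\<And>r r'. r \<in> R \<Longrightarrow> r' \<in> R \<Longrightarrow> mat_cong m r r' \<Longrightarrow> r = r'"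
  using assms by (simp_all add: GL_representatives_def)

lemma finite_vectors:
  assumes "finite R"
  shows "finite {x :: 'a ^ 'n. \<forall>i. x $ i \<in> R}"
proof (rule finite_subset)
  show "{x :: 'a ^ 'n. \<forall>i. x $ i \<in> R} \<subseteq> vec_lambda ` (PiE UNIV (\<lambda>_. R))"
  proof
    fix x :: "'a ^ 'n"
    assume "x \<in> {x. \<forall>i. x $ i \<in> R}"
    then have "(\<lambda>i. x $ i) \<in> PiE UNIV (\<lambda>_. R)" and "x = vec_lambda (\<lambda>i. x $ i)"
      by auto
    then show "x \<in> vec_lambda ` (PiE UNIV (\<lambda>_. R))"
      by blast
  qed
  show "finite (vec_lambda ` (PiE UNIV (\<lambda>_. R)) :: ('a ^ 'n) set)"
    using assms by (intro finite_imageI finite_PiE) simp_all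
qed

text \<open>Entries have finitely many residues, so there are finitely many classes; one element is
  chosen from each.\<close>

lemma GL_representatives_exist:
  "\<exists>R :: ('a::nonarch_local_field ^ 'n ^ 'n) set. GL_representatives m R"
proof -
  define cl where "cl = (\<lambda>k :: 'a ^ 'n ^ 'n. {g \<in> GL_integers. mat_cong m k g})"
  obtain S :: "'a set" where S: "finite S" "\<And>x. absval x \<le> 1 \<Longrightarrow> \<exists>r\<in>S. x - r \<in> ideal_power m"
    by (rule finite_representatives[where 'a='a and m=m]) blast
  have fin: "finite {A :: 'a ^ 'n ^ 'n. \<forall>i. A $ i \<in> {x. \<forall>j. x $ j \<in> S}}"
    using S(1) by (intro finite_vectors)
  \<comment> \<open>The matrix \<open>A\<close> of entrywise representatives need not be invertible;
    hence \<open>cl\<close> accepts arbitrary matrices, while its values contain only invertible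
    ones.\<close>
  have "cl ` GL_integers \<subseteq> cl ` {A. \<forall>i. A $ i \<in> {x. \<forall>j. x $ j \<in> S}}"
  proof (rule image_subsetI)
    fix k :: "'a ^ 'n ^ 'n"
    assume "k \<in> GL_integers"
    then have "\<forall>i j. \<exists>r\<in>S. k $ i $ j - r \<in> ideal_power m"
      using S(2) by (simp add: GL_integers_integral integral_matrices_absval)
    then obtain r where r: "\<And>i j. r i j \<in> S" "\<And>i j. k $ i $ j - r i j \<in> ideal_power m"
      by metis
    define A where "A = (\<chi> i j. r i j)"
    have "mat_cong m k A"
      using r(2) by (simp add: A_def mat_cong_def vec_cong_def)
    then have "cl k = cl A"
      unfolding cl_def using mat_cong_trans mat_cong_sym by blast
    moreover have "A \<in> {A. \<forall>i. A $ i \<in> {x. \<forall>j. x $ j \<in> S}}"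
      using r(1) by (simp add: A_def)
    ultimately show "cl k \<in> cl ` {A. \<forall>i. A $ i \<in> {x. \<forall>j. x $ j \<in> S}}"
      by blast
  qed
  then have fin': "finite (cl ` GL_integers)"
    using fin by (rule finite_subset[OF _ finite_imageI])
  define pick where "pick = (\<lambda>C :: ('a ^ 'n ^ 'n) set. SOME k. k \<in> C)"
  have pick: "pick (cl k) \<in> GL_integers \<and> mat_cong m k (pick (cl k))" if "k \<in> GL_integers" for k
  proof -
    have "k \<in> cl k"
      using that by (simp add: cl_def)
    then have "pick (cl k) \<in> cl k"
      unfolding pick_def by (rule someI)
    then show ?thesis
      by (simp add: cl_def)
  qed
  have "GL_representatives m (pick ` cl ` GL_integers)"
    unfolding GL_representatives_def
  proof (intro conjI ballI impI)
    show "finite (pick ` cl ` GL_integers)"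
      using fin' by (rule finite_imageI)
    show "pick ` cl ` GL_integers \<subseteq> GL_integers"
      using pick by blast
    show "\<exists>r\<in>pick ` cl ` GL_integers. mat_cong m k r" if "k \<in> GL_integers" for k
      using pick that by blast
    show "r = r'" if rr': "r \<in> pick ` cl ` GL_integers" "r' \<in> pick ` cl ` GL_integers" "mat_cong m r r'"
      for r r'
    proof -
      obtain k k' where k: "k \<in> GL_integers" "r = pick (cl k)" "k' \<in> GL_integers" "r' = pick (cl k')"
        using rr' by blast
      have "mat_cong m k k'"
        using pick[OF k(1)] pick[OF k(3)] k(2,4) rr'(3) mat_cong_trans mat_cong_sym by metis
      then have "cl k = cl k'"
        unfolding cl_def using mat_cong_trans mat_cong_sym by blast
      then show ?thesis
        using k by simp
    qed
  qed
  then show ?thesis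
    by blast
qed

section \<open>Haar measure of congruence classes\<close>

lemma haar_probability_space: "haar_probability M \<Longrightarrow> space M = GL_integers"
  unfolding haar_probability_def by (metis sets_eq_imp_space_eq space_restrict_space space_borel Int_UNIV_right)

lemma haar_mat_cong_class_sets:
  assumes "haar_probability M"
  shows "{k \<in> GL_integers. mat_cong m k r} \<in> sets M"
proof -
  have "{k. mat_cong m k r} \<in> sets borel"
    by (intro borel_open open_mat_cong)
  then have "{k. mat_cong m k r} \<inter> GL_integers \<in> sets (restrict_space borel GL_integers)"
    by (auto simp: sets_restrict_space)
  moreover have "{k. mat_cong m k r} \<inter> GL_integers = {k \<in> GL_integers. mat_cong m k r}"
    by blast
  ultimately show ?thesis
    using assms by (simp add: haar_probability_def)
qed

text \<open>Left multiplication by \<open>r\<close> carries the class of the identity onto that of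
  \<open>r\<close>, with \<open>matrix_inv r\<close> for the reverse inclusion; left invariance
  compares the measures.\<close>

lemma haar_mat_cong_class_measure:
  assumes M: "haar_probability M" and r: "r \<in> GL_integers"
  shows "measure M {k \<in> GL_integers. mat_cong m k r} = measure M {k \<in> GL_integers. mat_cong m k (mat 1)}"
proof -
  let ?N = "{k \<in> GL_integers. mat_cong m k (mat 1)}"
  have "(\<lambda>g. r ** g) ` ?N = {k \<in> GL_integers. mat_cong m k r}"
  proof (intro equalityI subsetI)
    fix k
    assume "k \<in> (\<lambda>g. r ** g) ` ?N"
    then obtain g where g: "g \<in> GL_integers" "mat_cong m g (mat 1)" "k = r ** g"
      by blast
    have "mat_cong m (r ** g) (r ** mat 1)"
      using g r by (intro mat_cong_mult_left) (simp_all add: GL_integers_integral)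
    then show "k \<in> {k \<in> GL_integers. mat_cong m k r}"
      using g r by (simp add: GL_integers_mult)
  next
    fix k
    assume "k \<in> {k \<in> GL_integers. mat_cong m k r}"
    then have k: "k \<in> GL_integers" "mat_cong m k r"
      by auto
    note inv = GL_integers_matrix_inv[OF r]
    have "mat_cong m (matrix_inv r ** k) (matrix_inv r ** r)"
      using k inv by (intro mat_cong_mult_left) (simp_all add: GL_integers_integral)
    then have "matrix_inv r ** k \<in> ?N"
      using k inv by (simp add: GL_integers_mult)
    moreover have "k = r ** (matrix_inv r ** k)"
      by (simp add: matrix_mul_assoc inv)
    ultimately show "k \<in> (\<lambda>g. r ** g) ` ?N"
      by (rule rev_image_eqI)
  qed
  moreover have "emeasure M ((\<lambda>g. r ** g) ` ?N) = emeasure M ?N"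
    using M r haar_mat_cong_class_sets[OF M] unfolding haar_probability_def by blast
  ultimately show ?thesis
    by (simp add: measure_def)
qed

text \<open>On the group, \<open>F\<close> is a finite combination of indicators of disjoint
  classes, all of measure \<open>1 / card R\<close>.\<close>

lemma haar_integral_average:
  fixes M :: "('a::nonarch_local_field ^ 'n ^ 'n) measure"
  assumes M: "haar_probability M"
    and "GL_representatives m R"
    and F: "mat_cong_invariant m F"
  shows "has_bochner_integral M F ((\<Sum>r\<in>R. F r) / of_nat (card R))"
proof -
  note R = GL_representativesD[OF assms(2)]
  interpret prob_space M
    using M by (simp add: haar_probability_def)
  define cl where "cl = (\<lambda>r :: 'a ^ 'n ^ 'n. {k \<in> GL_integers. mat_cong m k r})"
  have space: "space M = GL_integers"
    using M by (rule haar_probability_space)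
  have sets: "cl r \<in> sets M" for r
    unfolding cl_def using M by (rule haar_mat_cong_class_sets)
  have disj: "disjoint_family_on cl R"
    unfolding disjoint_family_on_def
  proof (intro ballI impI equals0I)
    fix r s k
    assume rs: "r \<in> R" "s \<in> R" "r \<noteq> s" and "k \<in> cl r \<inter> cl s"
    then have "mat_cong m r k" "mat_cong m k s"
      by (auto simp: cl_def intro: mat_cong_sym)
    then have "mat_cong m r s"
      by (rule mat_cong_trans)
    then show False
      using R(4) rs by blast
  qed
  have cover: "(\<Union>r\<in>R. cl r) = GL_integers"
    unfolding cl_def using R(3) by blast
  define c where "c = measure M (cl (mat 1))"
  have cl: "measure M (cl r) = c" if "r \<in> R" for r
    unfolding cl_def c_def using haar_mat_cong_class_measure[OF M] R(2) that by blast
  \<comment> \<open>Total mass \<open>1\<close> determines the common measure \<open>c\<close> and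
    also excludes an empty \<open>R\<close>.\<close>
  have "1 = measure M (\<Union>r\<in>R. cl r)"
    using prob_space space cover by simp
  also have "\<dots> = (\<Sum>r\<in>R. measure M (cl r))"
    using R(1) sets disj by (intro finite_measure_finite_Union) auto
  also have "\<dots> = real (card R) * c"
    using cl by simp
  finally have card: "real (card R) * c = 1"
    by simp
  then have c: "c = 1 / real (card R)"
    by (cases "card R = 0") (auto simp: field_simps)
  have int: "has_bochner_integral M (\<lambda>k. \<Sum>r\<in>R. indicator (cl r) k *\<^sub>R F r) (\<Sum>r\<in>R. measure M (cl r) *\<^sub>R F r)"
    using sets by (intro has_bochner_integral_sum has_bochner_integral_indicator)
      (auto simp: emeasure_eq_measure)
  have val: "(\<Sum>r\<in>R. indicator (cl r) k *\<^sub>R F r) = F k" if "k \<in> space M" for k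
  proof -
    have kM: "k \<in> GL_integers"
      using that by (simp only: space)
    obtain r where r: "r \<in> R" "mat_cong m k r"
      using R(3)[OF kM] by blast
    have "indicator (cl s) k *\<^sub>R F s = (if s = r then F k else 0)" if "s \<in> R" for s
    proof (cases "s = r")
      case True
      have "F k = F r"
        using kM subsetD[OF R(2) r(1)] r(2) by (rule mat_cong_invariantD[OF F])
      then show ?thesis
        using True r(2) kM by (simp add: cl_def)
    next
      case False
      have "\<not> mat_cong m k s"
        using False R(4)[OF that r(1)] r(2) mat_cong_trans mat_cong_sym by metis
      then show ?thesis
        using False by (simp add: cl_def)
    qed
    then show ?thesis
      using R(1) r(1) by simp
  qed
  have sum: "(\<Sum>r\<in>R. measure M (cl r) *\<^sub>R F r) = (\<Sum>r\<in>R. F r) / of_nat (card R)"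
    using cl by (simp add: c scaleR_conv_of_real sum_divide_distrib)
  have "has_bochner_integral M (\<lambda>k. \<Sum>r\<in>R. indicator (cl r) k *\<^sub>R F r) (\<Sum>r\<in>R. measure M (cl r) *\<^sub>R F r)
      \<longleftrightarrow> ?thesis"
    by (intro has_bochner_integral_cong refl val sum)
  then show ?thesis
    using int by (rule iffD1)
qed

lemma haar_integrable:
  fixes M :: "('a::nonarch_local_field ^ 'n ^ 'n) measure"
  assumes "haar_probability M" and "mat_cong_invariant m F"
  shows "integrable M F"
proof -
  obtain R :: "('a ^ 'n ^ 'n) set" where "GL_representatives m R"
    using GL_representatives_exist by blast
  from haar_integral_average[OF assms(1) this assms(2)] show ?thesis
    by (rule integrable.intros)
qed

text \<open>Right translation permutes the finitely many classes, all of equal measure by left invariance.\<close>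

lemma haar_integral_right_translate:
  fixes M :: "('a::nonarch_local_field ^ 'n ^ 'n) measure"
  assumes M: "haar_probability M" and F: "mat_cong_invariant m F" and g: "g \<in> GL_integers"
  shows "(LINT k|M. F (k ** g)) = (LINT k|M. F k)"
proof -
  obtain R :: "('a ^ 'n ^ 'n) set" where GR: "GL_representatives m R"
    using GL_representatives_exist by blast
  note R = GL_representativesD[OF GR]
  have gR: "r ** g \<in> GL_integers" if "r \<in> R" for r
    using that R(2) g by (auto intro: GL_integers_mult)
  then have "\<forall>r\<in>R. \<exists>s\<in>R. mat_cong m (r ** g) s"
    using R(3) by blast
  then obtain p where p: "\<And>r. r \<in> R \<Longrightarrow> p r \<in> R \<and> mat_cong m (r ** g) (p r)"
    by metis
  \<comment> \<open>Translates with the same representative are brought back to congruent matrices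
    by \<open>matrix_inv g\<close>; finiteness then makes \<open>p\<close> a permutation.\<close>
  have "inj_on p R"
  proof (rule inj_onI)
    fix r s
    assume rs: "r \<in> R" "s \<in> R" "p r = p s"
    have "mat_cong m (r ** g) (s ** g)"
      using p[OF rs(1)] p[OF rs(2)] rs(3) mat_cong_trans mat_cong_sym by metis
    then have "mat_cong m ((r ** g) ** matrix_inv g) ((s ** g) ** matrix_inv g)"
      by (rule mat_cong_mult_right[OF GL_integers_integral[OF GL_integers_matrix_inv(1)[OF g]]])
    then have "mat_cong m r s"
      by (simp add: matrix_mul_assoc[symmetric] GL_integers_matrix_inv[OF g])
    then show "r = s"
      using R(4) rs by blast
  qed
  moreover have "p ` R = R"
    using p calculation by (intro endo_inj_surj R(1)) auto
  ultimately have p_bij: "bij_betw p R R"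
    by (simp add: bij_betw_def)
  have inv: "mat_cong_invariant m (\<lambda>k. F (k ** g))"
    using F g unfolding mat_cong_invariant_def
    by (auto intro: GL_integers_mult mat_cong_mult_right GL_integers_integral)
  have "(\<Sum>r\<in>R. F (r ** g)) = (\<Sum>r\<in>R. F (p r))"
    using p gR R(2) by (intro sum.cong mat_cong_invariantD[OF F]) auto
  also have "\<dots> = (\<Sum>r\<in>R. F r)"
    using p_bij by (rule sum.reindex_bij_betw)
  finally show ?thesis
    using has_bochner_integral_integral_eq[OF haar_integral_average[OF M GR inv]]
      has_bochner_integral_integral_eq[OF haar_integral_average[OF M GR F]] by simp
qed

text \<open>The integral is a finite average of squared moduli, so its vanishing kills
  \<open>F\<close> on every class, without exceptional null sets.\<close>

lemma haar_integral_norm_square_eq_0: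
  fixes M :: "('a::nonarch_local_field ^ 'n ^ 'n) measure"
  assumes M: "haar_probability M" and F: "mat_cong_invariant m F"
    and zero: "(LINT k|M. F k * cnj (F k)) = 0" and g: "g \<in> GL_integers"
  shows "F g = 0"
proof -
  obtain R :: "('a ^ 'n ^ 'n) set" where GR: "GL_representatives m R"
    using GL_representatives_exist by blast
  note R = GL_representativesD[OF GR]
  have "mat_cong_invariant m (\<lambda>k. F k * cnj (F k))"
    using F unfolding mat_cong_invariant_def by metis
  then have "(\<Sum>r\<in>R. F r * cnj (F r)) / of_nat (card R) = 0"
    using haar_integral_average[OF M GR, THEN has_bochner_integral_integral_eq] zero by metis
  moreover obtain s where s: "s \<in> R" "mat_cong m g s"
    using R(3) g by blast
  ultimately have "(\<Sum>r\<in>R. F r * cnj (F r)) = 0"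
    using R(1) by auto
  then have "complex_of_real (\<Sum>r\<in>R. (cmod (F r))\<^sup>2) = 0"
    by (simp only: of_real_sum complex_norm_square)
  then have "(\<Sum>r\<in>R. (cmod (F r))\<^sup>2) = 0"
    by (simp only: of_real_eq_0_iff)
  then have "F s = 0"
    using R(1) s(1) by (simp add: sum_nonneg_eq_0_iff)
  moreover have "F g = F s"
    using g s R(2) by (intro mat_cong_invariantD[OF F]) auto
  ultimately show ?thesis
    by simp
qed

section \<open>Level spaces\<close>

text \<open>Local constancy is automatic for functions of the residue modulo \<open>\<pp>\<^sup>m\<close>.\<close>

lemma level_space_iff:
  fixes f :: "'a::nonarch_local_field ^ 'n \<Rightarrow> complex"
  shows
  "f \<in> level_space \<omega> m \<longleftrightarrow>
     (\<forall>x. x \<notin> unit_sphere \<longrightarrow> f x = 0) \<and>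
     (\<forall>x \<in> unit_sphere. \<forall>y \<in> unit_sphere. vec_cong m y x \<longrightarrow> f y = f x) \<and>
     (\<forall>a \<in> integer_units. \<forall>x \<in> unit_sphere. f (a *s x) = \<omega> a * f x)"
  (is "_ \<longleftrightarrow> ?R")
proof
  assume f: "f \<in> level_space \<omega> m"
  have "f y = f x" if xy: "x \<in> unit_sphere" "y \<in> unit_sphere" "vec_cong m y x" for x y :: "'a ^ 'n"
  proof -
    obtain k where "k \<in> congruence_subgroup m" "x v* k = y"
      using congruence_subgroup_transitive[OF xy] by blast
    then show ?thesis
      using f xy(1) unfolding level_space_def by blast
  qed
  then show ?R
    using f unfolding level_space_def smooth_functions_def by blast
next
  assume R: ?R
  have "f \<in> smooth_functions"
    unfolding smooth_functions_def mem_Collect_eq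
  proof (intro conjI ballI)
    fix x :: "'a ^ 'n"
    assume x: "x \<in> unit_sphere"
    show "\<exists>U. open U \<and> x \<in> U \<and> (\<forall>y\<in>unit_sphere \<inter> U. f y = f x)"
    proof (intro exI[of _ "{y. vec_cong m y x}"] conjI ballI)
      show "open {y. vec_cong m y x}"
        by (rule open_vec_cong)
      show "f y = f x" if "y \<in> unit_sphere \<inter> {y. vec_cong m y x}" for y
        using R x that by blast
    qed simp
  qed (use R in blast)
  moreover have "f (x v* k) = f x" if k: "k \<in> congruence_subgroup m" and x: "x \<in> unit_sphere"
    for k and x :: "'a ^ 'n"
  proof -
    have "k \<in> GL_integers" and "mat_cong m k (mat 1)"
      using k by (simp_all add: congruence_subgroup_def mat_cong_def vec_cong_def)
    then have "x v* k \<in> unit_sphere" and "vec_cong m (x v* k) (x v* mat 1)"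
      using x by (simp_all only: unit_sphere_vector_matrix vec_cong_vector_matrix_left unit_sphere_absval)
    then show ?thesis
      using R x by (simp only: vector_matrix_mul_rid)
  qed
  ultimately show "f \<in> level_space \<omega> m"
    using R unfolding level_space_def by blast
qed

lemma level_spaceD:
  assumes "f \<in> level_space \<omega> m"
  shows "x \<notin> unit_sphere \<Longrightarrow> f x = 0"
    and "x \<in> unit_sphere \<Longrightarrow> y \<in> unit_sphere \<Longrightarrow> vec_cong m y x \<Longrightarrow> f y = f x"
    and "a \<in> integer_units \<Longrightarrow> x \<in> unit_sphere \<Longrightarrow> f (a *s x) = \<omega> a * f x"
  using assms unfolding level_space_iff by blast+

lemma level_spaceI:
  assumes "\<And>x. x \<notin> unit_sphere \<Longrightarrow> f x = 0"
    and "\<And>x y. x \<in> unit_sphere \<Longrightarrow> y \<in> unit_sphere \<Longrightarrow> vec_cong m y x \<Longrightarrow> f y = f x"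
    and "\<And>a x. a \<in> integer_units \<Longrightarrow> x \<in> unit_sphere \<Longrightarrow> f (a *s x) = \<omega> a * f x"
  shows "f \<in> level_space \<omega> m"
  using assms unfolding level_space_iff by blast

lemma level_space_subspace:
  "cfun.subspace (level_space \<omega> m :: ('a::nonarch_local_field ^ 'n \<Rightarrow> complex) set)"
  unfolding cfun.subspace_def
proof (intro conjI ballI allI)
  show "0 \<in> level_space \<omega> m"
    by (rule level_spaceI) simp_all
next
  fix f g :: "'a ^ 'n \<Rightarrow> complex"
  assume fg: "f \<in> level_space \<omega> m" "g \<in> level_space \<omega> m"
  show "f + g \<in> level_space \<omega> m"
  proof (rule level_spaceI)
    show "(f + g) x = 0" if "x \<notin> unit_sphere" for x
      using level_spaceD(1)[OF fg(1) that] level_spaceD(1)[OF fg(2) that] by simp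
    show "(f + g) y = (f + g) x" if "x \<in> unit_sphere" "y \<in> unit_sphere" "vec_cong m y x" for x y
      using level_spaceD(2)[OF fg(1) that] level_spaceD(2)[OF fg(2) that] by simp
    show "(f + g) (a *s x) = \<omega> a * (f + g) x" if "a \<in> integer_units" "x \<in> unit_sphere" for a x
      using level_spaceD(3)[OF fg(1) that] level_spaceD(3)[OF fg(2) that] by (simp add: distrib_left)
  qed
next
  fix c and f :: "'a ^ 'n \<Rightarrow> complex"
  assume f: "f \<in> level_space \<omega> m"
  show "fun_scale c f \<in> level_space \<omega> m"
  proof (rule level_spaceI)
    show "fun_scale c f x = 0" if "x \<notin> unit_sphere" for x
      using level_spaceD(1)[OF f that] by (simp add: fun_scale_def)
    show "fun_scale c f y = fun_scale c f x" if "x \<in> unit_sphere" "y \<in> unit_sphere" "vec_cong m y x" for x y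
      using level_spaceD(2)[OF f that] by (simp add: fun_scale_def)
    show "fun_scale c f (a *s x) = \<omega> a * fun_scale c f x" if "a \<in> integer_units" "x \<in> unit_sphere" for a x
      using level_spaceD(3)[OF f that] by (simp add: fun_scale_def)
  qed
qed

lemma level_space_mono: "m \<le> n \<Longrightarrow> f \<in> level_space \<omega> m \<Longrightarrow> f \<in> level_space \<omega> n"
  unfolding level_space_iff using vec_cong_mono by blast

text \<open>Integral matrices preserve congruence of vectors; this takes the place of the normality
  of \<open>congruence_subgroup m\<close> in \<open>GL_integers\<close>.\<close>

lemma level_space_translate:
  assumes f: "f \<in> level_space \<omega> m" and k: "k \<in> GL_integers"
  shows "(\<lambda>x. f (x v* k)) \<in> level_space \<omega> m"
proof (rule level_spaceI)
  show "f (x v* k) = 0" if "x \<notin> unit_sphere" for x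
    using that unit_sphere_vector_matrix_iff[OF k] by (intro level_spaceD(1)[OF f]) blast
  show "f (y v* k) = f (x v* k)" if "x \<in> unit_sphere" "y \<in> unit_sphere" "vec_cong m y x" for x y
    using that by (intro level_spaceD(2)[OF f] unit_sphere_vector_matrix[OF k]
      vec_cong_vector_matrix[OF GL_integers_integral[OF k]])
  show "f (a *s x v* k) = \<omega> a * f (x v* k)" if "a \<in> integer_units" "x \<in> unit_sphere" for a x
  proof -
    have "a *s x v* k = a *s (x v* k)"
      by (simp add: vec_eq_iff vector_matrix_nth sum_distrib_left mult.left_commute)
    then show ?thesis
      using level_spaceD(3)[OF f that(1) unit_sphere_vector_matrix[OF k that(2)]] by simp
  qed
qed

text \<open>Congruent matrices send \<open>e_last\<close> to congruent vectors, which brings inner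
  products on level spaces within reach of the finite averages.\<close>

lemma level_space_mat_cong_invariant:
  fixes f :: "'a::nonarch_local_field ^ ('m::finite option) \<Rightarrow> complex"
  assumes f: "f \<in> level_space \<omega> m"
  shows "mat_cong_invariant m (\<lambda>k. f (e_last v* k))"
  unfolding mat_cong_invariant_def
proof (intro ballI impI)
  fix k k' :: "'a ^ ('m option) ^ ('m option)"
  assume kk': "k \<in> GL_integers" "k' \<in> GL_integers" "mat_cong m k k'"
  have "vec_cong m (e_last v* k) (e_last v* k')"
    using kk'(3) unit_sphere_absval[OF e_last_in_unit_sphere] by (rule vec_cong_vector_matrix_left)
  then show "f (e_last v* k) = f (e_last v* k')"
    using kk'(1,2) by (intro level_spaceD(2)[OF f] unit_sphere_vector_matrix e_last_in_unit_sphere)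
qed

lemma mat_cong_invariant_times_cnj:
  assumes "mat_cong_invariant m F" and "mat_cong_invariant m G"
  shows "mat_cong_invariant m (\<lambda>k. F k * cnj (G k))"
  unfolding mat_cong_invariant_def
  using mat_cong_invariantD[OF assms(1)] mat_cong_invariantD[OF assms(2)] by metis

section \<open>The inner product on level spaces\<close>

lemma sphere_inner_scale: "sphere_inner M (fun_scale c f) h = c * sphere_inner M f h"
  by (simp add: sphere_inner_def fun_scale_def mult.assoc)

lemma sphere_inner_zero: "sphere_inner M 0 h = 0"
  by (simp add: sphere_inner_def)

lemma sphere_inner_commute: "sphere_inner M g f = cnj (sphere_inner M f g)"
  unfolding sphere_inner_def
  by (simp add: mult.commute flip: Bochner_Integration.integral_cnj)

lemma harmonic_space_level: "f \<in> harmonic_space M \<omega> m \<Longrightarrow> f \<in> level_space \<omega> m"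
  by (simp add: harmonic_space_def split: if_splits)

context
  fixes M :: "('a::nonarch_local_field ^ ('m::finite option) ^ ('m option)) measure"
  assumes M: "haar_probability M"
begin

lemma sphere_inner_integrable:
  assumes "f \<in> level_space \<omega> m" and "g \<in> level_space \<omega> m"
  shows "integrable M (\<lambda>k. f (e_last v* k) * cnj (g (e_last v* k)))"
  using assms by (intro haar_integrable[OF M] mat_cong_invariant_times_cnj level_space_mat_cong_invariant)

lemma sphere_inner_add:
  assumes "f \<in> level_space \<omega> m" and "g \<in> level_space \<omega> m" and "h \<in> level_space \<omega> m"
  shows "sphere_inner M (f + g) h = sphere_inner M f h + sphere_inner M g h"
  unfolding sphere_inner_def plus_fun_apply distrib_right
  using assms by (intro Bochner_Integration.integral_add sphere_inner_integrable)

lemma sphere_inner_translate: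
  assumes f: "f \<in> level_space \<omega> m" and g: "g \<in> level_space \<omega> m" and k: "k \<in> GL_integers"
  shows "sphere_inner M (\<lambda>x. f (x v* k)) (\<lambda>x. g (x v* k)) = sphere_inner M f g"
proof -
  have "mat_cong_invariant m (\<lambda>k. f (e_last v* k) * cnj (g (e_last v* k)))"
    using f g by (intro mat_cong_invariant_times_cnj level_space_mat_cong_invariant)
  from haar_integral_right_translate[OF M this k] show ?thesis
    by (simp add: sphere_inner_def vector_matrix_mul_assoc)
qed

text \<open>Definiteness holds pointwise because \<open>GL_integers\<close> moves
  \<open>e_last\<close> to every point of the sphere.\<close>

lemma sphere_inner_self_eq_0:
  assumes f: "f \<in> level_space \<omega> m" and zero: "sphere_inner M f f = 0"
  shows "f x = 0"
proof (cases "x \<in> unit_sphere")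
  case True
  then obtain k where k: "k \<in> GL_integers" "x = e_last v* k"
    using e_last_orbit by blast
  show ?thesis
    unfolding k(2)
    using haar_integral_norm_square_eq_0[OF M level_space_mat_cong_invariant[OF f] _ k(1)] zero
    by (simp add: sphere_inner_def)
next
  case False
  then show ?thesis
    by (rule level_spaceD(1)[OF f])
qed

section \<open>Harmonic spaces\<close>

lemma harmonic_space_subspace: "cfun.subspace (harmonic_space M \<omega> m)"
proof (cases "m = conductor_exponent \<omega>")
  case True
  then show ?thesis
    by (simp add: harmonic_space_def level_space_subspace)
next
  case False
  note sub = level_space_subspace[where 'n="'m option" and \<omega>=\<omega> and m=m, unfolded cfun.subspace_def]
  \<comment> \<open>Truncated subtraction keeps \<open>m - 1 \<le> m\<close> true at
    \<open>m = 0\<close>; additivity of the inner product needs the test functions at level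
    \<open>m\<close>.\<close>
  have mono: "g \<in> level_space \<omega> m" if "g \<in> level_space \<omega> (m - 1)" for g :: "'a ^ ('m option) \<Rightarrow> complex"
    using that by (rule level_space_mono[rotated]) simp
  show ?thesis
    unfolding cfun.subspace_def
  proof (intro conjI ballI allI)
    show "0 \<in> harmonic_space M \<omega> m"
      using False sub by (simp add: harmonic_space_def sphere_inner_zero)
    show "f + g \<in> harmonic_space M \<omega> m"
      if "f \<in> harmonic_space M \<omega> m" "g \<in> harmonic_space M \<omega> m" for f g
      using False sub that mono by (auto simp: harmonic_space_def sphere_inner_add)
    show "fun_scale c f \<in> harmonic_space M \<omega> m" if "f \<in> harmonic_space M \<omega> m" for c f
      using False sub that by (auto simp: harmonic_space_def sphere_inner_scale)
  qed
qed

text \<open>Translation preserves the inner product and maps the space of level \<open>m - 1\<close>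
  onto itself, hence it preserves the orthogonal complement.\<close>

lemma harmonic_space_translate:
  assumes f: "f \<in> harmonic_space M \<omega> m" and k: "k \<in> GL_integers"
  shows "(\<lambda>x. f (x v* k)) \<in> harmonic_space M \<omega> m"
proof (cases "m = conductor_exponent \<omega>")
  case True
  then show ?thesis
    using f k by (simp add: harmonic_space_def level_space_translate)
next
  case False
  have fl: "f \<in> level_space \<omega> m"
    using f by (rule harmonic_space_level)
  have "sphere_inner M (\<lambda>x. f (x v* k)) g = 0" if g: "g \<in> level_space \<omega> (m - 1)" for g
  proof -
    define h where "h = (\<lambda>x. g (x v* matrix_inv k))"
    have h: "h \<in> level_space \<omega> (m - 1)"
      unfolding h_def by (rule level_space_translate[OF g GL_integers_matrix_inv(1)[OF k]])
    have "g = (\<lambda>x. h (x v* k))"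
      by (simp add: h_def vector_matrix_matrix_inv(1)[OF k])
    then have "sphere_inner M (\<lambda>x. f (x v* k)) g = sphere_inner M f h"
      using sphere_inner_translate[OF fl level_space_mono[OF _ h] k] by simp
    also have "\<dots> = 0"
      using f h False by (simp add: harmonic_space_def)
    finally show ?thesis .
  qed
  then show ?thesis
    using False level_space_translate[OF fl k] by (simp add: harmonic_space_def)
qed

section \<open>Functions with a zero at \<open>e_last\<close>\<close>

lemma mirabolic_invariant_near_e_last:
  fixes f :: "'a ^ ('m option) \<Rightarrow> complex"
  assumes f: "f \<in> level_space \<omega> m" and f0: "f e_last = 0"
    and x: "x \<in> unit_sphere" and near: "\<And>i. x $ Some i \<in> ideal_power m"
  shows "f x = 0"
proof (cases "m = 0")
  case True
  have "vec_cong m x e_last"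
    using x True unit_sphere_absval[OF e_last_in_unit_sphere]
    by (auto simp: vec_cong_def integers_iff unit_sphere_absval intro!: absval_diff_le)
  then show ?thesis
    using level_spaceD(2)[OF f e_last_in_unit_sphere x] f0 by simp
next
  case False
  \<comment> \<open>The other coordinates lie in the maximal ideal, so \<open>a\<close> is a unit
    and \<open>x\<close> is congruent to \<open>a *s e_last\<close>; equivariance transports the
    zero.\<close>
  define a where "a = x $ None"
  have "absval (x $ Some i) < 1" for i
    using ideal_power_less_1[OF near] False by simp
  then have "absval a = 1"
    using x unfolding unit_sphere_iff a_def by (metis less_irrefl not_None_eq)
  then have a: "a \<in> integer_units"
    by (simp add: integer_units_iff)
  have "x $ l - (a *s e_last) $ l \<in> ideal_power m" for l
    using near by (cases l) (simp_all add: e_last_nth a_def)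
  then have "vec_cong m x (a *s e_last)"
    by (simp add: vec_cong_def)
  then have "f x = f (a *s e_last)"
    using x a by (intro level_spaceD(2)[OF f]) (simp_all add: unit_sphere_scale)
  also have "\<dots> = 0"
    using level_spaceD(3)[OF f a e_last_in_unit_sphere] f0 by simp
  finally show ?thesis .
qed

text \<open>At the conductor the character kills every mirabolic orbit except that of \<open>e_last\<close>.\<close>

lemma mirabolic_invariant_conductor_eq_0:
  fixes f :: "'a ^ ('m option) \<Rightarrow> complex"
  assumes f: "f \<in> level_space \<omega> (conductor_exponent \<omega>)"
    and inv: "\<And>x k. x \<in> unit_sphere \<Longrightarrow> k \<in> mirabolic \<Longrightarrow> f (x v* k) = f x"
    and f0: "f e_last = 0" and x: "x \<in> unit_sphere"
  shows "f x = 0"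
proof (cases "\<forall>i. x $ Some i \<in> ideal_power (conductor_exponent \<omega>)")
  case True
  then show ?thesis
    using mirabolic_invariant_near_e_last[OF f f0 x] by blast
next
  case False
  define m where "m = conductor_exponent \<omega>"
  obtain i where i: "x $ Some i \<notin> ideal_power m"
    using False unfolding m_def by blast
  have m: "0 < m"
  proof (rule ccontr)
    assume "\<not> 0 < m"
    then show False
      using i x by (simp add: integers_iff unit_sphere_absval)
  qed
  \<comment> \<open>Minimality of the conductor exponent yields a unit \<open>a\<close>, congruent
    to \<open>1\<close> modulo \<open>\<pp>\<^sup>m\<^sup>-\<^sup>1\<close>, at which the character
    is not \<open>1\<close>.\<close>
  then have "m - 1 < (LEAST m. \<forall>a \<in> integer_units. a - 1 \<in> ideal_power m \<longrightarrow> \<omega> a = 1)"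
    unfolding m_def conductor_exponent_def by simp
  then have "\<not> (\<forall>a \<in> integer_units. a - 1 \<in> ideal_power (m - 1) \<longrightarrow> \<omega> a = 1)"
    by (rule not_less_Least)
  then obtain a where a: "a \<in> integer_units" "a - 1 \<in> ideal_power (m - 1)" "\<omega> a \<noteq> 1"
    by blast
  \<comment> \<open>Scaling by \<open>a\<close> changes \<open>x\<close> by at most the size of
    \<open>x $ Some i\<close>, which lies outside \<open>\<pp>\<^sup>m\<close>; so
    \<open>a *s x\<close> stays in the mirabolic orbit of \<open>x\<close>.\<close>
  have "f (a *s x) = f x"
  proof (rule mirabolic_invariant_eq[of f x i "a *s x" i, OF inv x])
    show "x $ Some i \<noteq> 0"
      using i by auto
    show "absval ((a *s x) $ Some i) = absval (x $ Some i)"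
      using a(1) by (simp add: integer_units_iff absval_times)
    show "absval ((a *s x) $ l - x $ l) \<le> absval (x $ Some i)" for l
    proof -
      have "x $ l * (a - 1) \<in> ideal_power (m - 1)"
        using a(2) unit_sphere_absval[OF x] by (intro ideal_power_mult)
      moreover have "(a *s x) $ l - x $ l = x $ l * (a - 1)"
        by (simp add: algebra_simps)
      ultimately show ?thesis
        using ideal_power_discrete[OF i _ m] by simp
    qed
  qed
  then have "(\<omega> a - 1) * f x = 0"
    using level_spaceD(3)[OF f a(1) x] by (simp add: left_diff_distrib)
  then show ?thesis
    using a(3) by simp
qed

text \<open>Above the conductor, \<open>f\<close> is orthogonal to the function \<open>g\<close> of level \<open>m - 1\<close> that repeats on the
  smaller orbits the value of \<open>f\<close> on the orbits of size exactly \<open>q\<^sup>1\<^sup>-\<^sup>m\<close>. As \<open>f\<close> vanishes on the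
  smaller orbits, \<open>f\<close> times the conjugate of \<open>g\<close> is the square of the modulus of \<open>f\<close>.\<close>

lemma mirabolic_invariant_above_conductor_eq_0:
  fixes f :: "'a ^ ('m option) \<Rightarrow> complex"
  assumes f: "f \<in> level_space \<omega> m"
    and orth: "\<And>g. g \<in> level_space \<omega> (m - 1) \<Longrightarrow> sphere_inner M f g = 0"
    and inv: "\<And>x k. x \<in> unit_sphere \<Longrightarrow> k \<in> mirabolic \<Longrightarrow> f (x v* k) = f x"
    and f0: "f e_last = 0" and m: "0 < m"
  shows "f x = 0"
proof -
  obtain t :: 'a where t: "t \<noteq> 0" "\<And>x::'a. x \<in> ideal_power (m - 1) \<longleftrightarrow> absval x \<le> absval t"
    by (rule ideal_power_generator[of "m - 1", where 'a='a]) blast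
  \<comment> \<open>Since \<open>t\<close> generates \<open>\<pp>\<^sup>m\<^sup>-\<^sup>1\<close>,
    \<open>\<tau>\<close> moves a small vector to an orbit of size exactly
    \<open>q\<^sup>1\<^sup>-\<^sup>m\<close>, where the last coordinate matters only modulo
    \<open>t\<close>, as level \<open>m - 1\<close> requires.\<close>
  define \<tau> :: "'a ^ ('m option) \<Rightarrow> 'a ^ ('m option)"
    where "\<tau> = (\<lambda>x. \<chi> l. case l of None \<Rightarrow> x $ None | Some _ \<Rightarrow> t)"
  define small :: "'a ^ ('m option) \<Rightarrow> bool"
    where "small = (\<lambda>x. \<forall>i. x $ Some i \<in> ideal_power (m - 1))"
  define g where "g = (\<lambda>x. if x \<notin> unit_sphere then 0 else if small x then f (\<tau> x) else f x)"
  have \<tau>_nth: "\<tau> x $ None = x $ None" "\<tau> x $ Some i = t" for x i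
    by (simp_all add: \<tau>_def)
  have \<tau>_sphere: "\<tau> x \<in> unit_sphere" if x: "x \<in> unit_sphere" "small x" for x
  proof -
    have t1: "absval t \<le> 1"
      using ideal_power_le_1[of t "m - 1"] t(2) by simp
    have "absval (\<tau> x $ l) \<le> 1" for l
      using t1 unit_sphere_absval[OF x(1)] by (cases l) (simp_all add: \<tau>_nth)
    moreover obtain l where l: "absval (x $ l) = 1"
      using x(1) unfolding unit_sphere_iff by blast
    have "absval (\<tau> x $ l) = 1"
    proof (cases l)
      case None
      then show ?thesis
        using l by (simp add: \<tau>_nth)
    next
      \<comment> \<open>If the unit coordinate of \<open>x\<close> is among the first ones,
        smallness forces \<open>t\<close> to be a unit, so \<open>\<tau> x\<close> still has a unit
        coordinate.\<close>
      case (Some i)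
      then have "1 \<le> absval t"
        using l x(2) t(2) unfolding small_def by metis
      then show ?thesis
        using t1 Some by (simp add: \<tau>_nth)
    qed
    ultimately show ?thesis
      unfolding unit_sphere_iff by blast
  qed
  have \<tau>_eq: "f y = f (\<tau> x)"
    if x: "x \<in> unit_sphere" "small x" and y: "absval (y $ Some i) = absval t"
      "\<And>l. absval (y $ l - \<tau> x $ l) \<le> absval t" for x y i
  proof (rule mirabolic_invariant_eq[of f "\<tau> x" i y i, OF inv \<tau>_sphere[OF x]])
    show "\<tau> x $ Some i \<noteq> 0" "absval (y $ Some i) = absval (\<tau> x $ Some i)"
      "absval (y $ l - \<tau> x $ l) \<le> absval (\<tau> x $ Some i)" for l
      using t(1) y by (simp_all add: \<tau>_nth)
  qed
  have "g \<in> level_space \<omega> (m - 1)"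
  proof (rule level_spaceI)
    show "g x = 0" if "x \<notin> unit_sphere" for x
      using that by (simp add: g_def)
  next
    fix x y :: "'a ^ ('m option)"
    assume xy: "x \<in> unit_sphere" "y \<in> unit_sphere" "vec_cong (m - 1) y x"
    have diff: "absval (y $ l - x $ l) \<le> absval t" for l
      using xy(3) t(2) by (simp add: vec_cong_def)
    have small: "small y" if "small x" "vec_cong (m - 1) y x" for x y
      unfolding small_def
    proof
      fix i
      have "(y $ Some i - x $ Some i) + x $ Some i \<in> ideal_power (m - 1)"
        using that unfolding vec_cong_def small_def by (blast intro: ideal_power_add)
      then show "y $ Some i \<in> ideal_power (m - 1)"
        by simp
    qed
    show "g y = g x"
    proof (cases "small x")
      case True
      then have sy: "small y"
        using small xy(3) by blast
      have near: "absval (\<tau> y $ l - \<tau> x $ l) \<le> absval t" for l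
        using diff by (cases l) (simp_all add: \<tau>_nth)
      \<comment> \<open>All first coordinates of \<open>\<tau> y\<close> equal \<open>t\<close>, so
        any index serves as pivot, in particular \<open>undefined\<close>.\<close>
      have "f (\<tau> y) = f (\<tau> x)"
        by (rule \<tau>_eq[of x "\<tau> y" undefined, OF xy(1) True _ near]) (simp add: \<tau>_nth)
      then show ?thesis
        using True sy xy by (simp add: g_def)
    next
      case False
      then have sy: "\<not> small y"
        using small xy(3) vec_cong_sym by blast
      \<comment> \<open>A coordinate larger than \<open>t\<close> dominates the congruence modulo
        \<open>\<pp>\<^sup>m\<^sup>-\<^sup>1\<close>, so \<open>x\<close> and \<open>y\<close> lie
        in the same mirabolic orbit.\<close>
      obtain i where i: "absval t < absval (x $ Some i)"
        using False t(2) unfolding small_def by (meson not_le)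
      have "f y = f x"
      proof (rule mirabolic_invariant_eq[of f x i y i, OF inv xy(1)])
        show "x $ Some i \<noteq> 0"
          by (metis i absval_0 absval_nonneg not_less)
        show "absval (y $ Some i) = absval (x $ Some i)"
          using diff i by (intro absval_eq_if_near) (rule le_less_trans)
        show "absval (y $ l - x $ l) \<le> absval (x $ Some i)" for l
          using diff i by (meson less_imp_le order_trans)
      qed
      then show ?thesis
        using False sy xy by (simp add: g_def)
    qed
  next
    fix a :: 'a and x :: "'a ^ ('m option)"
    assume a: "a \<in> integer_units" and x: "x \<in> unit_sphere"
    have a1: "absval a = 1"
      using a by (simp add: integer_units_iff)
    have ax: "a *s x \<in> unit_sphere"
      using a x by (simp add: unit_sphere_scale)
    have small_iff: "small (a *s x) \<longleftrightarrow> small x"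
      by (simp only: small_def vector_smult_component t(2) absval_times a1 mult_1)
    show "g (a *s x) = \<omega> a * g x"
    proof (cases "small x")
      case True
      \<comment> \<open>Scaling by \<open>a\<close> turns the entries \<open>t\<close> into
        \<open>a * t\<close>, so it need not commute with \<open>\<tau>\<close>, but the two results
        lie in one mirabolic orbit.\<close>
      have near: "absval ((a *s \<tau> x) $ l - \<tau> (a *s x) $ l) \<le> absval t" for l
        using a1 by (cases l) (auto simp: \<tau>_nth absval_times intro!: absval_diff_le)
      have "f (a *s \<tau> x) = f (\<tau> (a *s x))"
        using True small_iff
        by (intro \<tau>_eq[of "a *s x" "a *s \<tau> x" undefined, OF ax _ _ near]) (simp_all add: \<tau>_nth absval_times a1)
      then show ?thesis
        using level_spaceD(3)[OF f a \<tau>_sphere[OF x True]] True small_iff x ax by (simp add: g_def)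
    next
      case False
      then show ?thesis
        using level_spaceD(3)[OF f a x] small_iff x ax by (simp add: g_def)
    qed
  qed
  then have "sphere_inner M f g = 0"
    by (rule orth)
  moreover have "f y * cnj (g y) = f y * cnj (f y)" for y
  proof (cases "y \<in> unit_sphere \<and> small y")
    case True
    show ?thesis
    proof (cases "\<forall>i. y $ Some i \<in> ideal_power m")
      case True
      then have "f y = 0"
        using mirabolic_invariant_near_e_last[OF f f0] \<open>y \<in> unit_sphere \<and> small y\<close> by blast
      then show ?thesis
        by simp
    next
      case False
      then obtain i where i: "y $ Some i \<notin> ideal_power m"
        by blast
      have le: "absval (y $ Some l) \<le> absval t" for l
        using True t(2) by (simp add: small_def)
      \<comment> \<open>Outside \<open>\<pp>\<^sup>m\<close> but inside
        \<open>\<pp>\<^sup>m\<^sup>-\<^sup>1\<close> only the size of \<open>t\<close> remains, so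
        \<open>y\<close> already lies in the orbit of \<open>\<tau> y\<close>.\<close>
      have "absval t \<le> absval (y $ Some i)"
        using t(2) by (intro ideal_power_discrete[OF i _ m]) simp
      then have "absval (y $ Some i) = absval t"
        using le[of i] by simp
      moreover have "absval (y $ l - \<tau> y $ l) \<le> absval t" for l
        using le by (cases l) (auto simp: \<tau>_nth intro!: absval_diff_le)
      ultimately have "f y = f (\<tau> y)"
        using \<tau>_eq True by blast
      then show ?thesis
        using True by (simp add: g_def)
    qed
  next
    case False
    then show ?thesis
      using level_spaceD(1)[OF f] by (auto simp: g_def)
  qed
  ultimately have "sphere_inner M f f = 0"
    by (simp add: sphere_inner_def)
  then show ?thesis
    by (rule sphere_inner_self_eq_0[OF f])
qed

text \<open>Applied to the difference of two candidates, this is the uniqueness of the zonal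
  spherical function.\<close>

lemma mirabolic_invariant_harmonic_eq_0:
  assumes f: "f \<in> harmonic_space M \<omega> m" and m: "conductor_exponent \<omega> \<le> m"
    and inv: "\<And>x k. x \<in> unit_sphere \<Longrightarrow> k \<in> mirabolic \<Longrightarrow> f (x v* k) = f x"
    and f0: "f e_last = 0"
  shows "f x = 0"
proof (cases "x \<in> unit_sphere")
  case x: True
  show ?thesis
  proof (cases "m = conductor_exponent \<omega>")
    case True
    then show ?thesis
      using mirabolic_invariant_conductor_eq_0[OF _ inv f0 x] harmonic_space_level[OF f] by simp
  next
    case False
    then have "sphere_inner M f g = 0" if "g \<in> level_space \<omega> (m - 1)" for g
      using f that by (simp add: harmonic_space_def)
    then show ?thesis
      using mirabolic_invariant_above_conductor_eq_0[OF harmonic_space_level[OF f] _ inv f0] False m by simp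
  qed
next
  case False
  then show ?thesis
    by (rule level_spaceD(1)[OF harmonic_space_level[OF f]])
qed

end

section \<open>The reproducing kernel\<close>

lemma sum_fun_apply: "(\<Sum>i\<in>I. f i) x = (\<Sum>i\<in>I. f i x)"
  for f :: "'i \<Rightarrow> 'b \<Rightarrow> 'c::comm_monoid_add"
  by (induction I rule: infinite_finite_induct) simp_all

definition basis_kernel :: "nat \<Rightarrow> (nat \<Rightarrow> 'b \<Rightarrow> complex) \<Rightarrow> 'b \<Rightarrow> 'b \<Rightarrow> complex" where
  "basis_kernel d Q x y = (\<Sum>j = 1..d. Q j x * cnj (Q j y))"

text \<open>The number \<open>d\<close> stays free here; the theorem sets it to the dimension of the
  harmonic space.\<close>

context
  fixes M :: "('a::nonarch_local_field ^ ('m::finite option) ^ ('m option)) measure"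
    and \<omega> :: "'a \<Rightarrow> complex" and m d :: nat
    and Q :: "nat \<Rightarrow> 'a ^ ('m option) \<Rightarrow> complex"
  assumes M: "haar_probability M"
    and ortho: "\<And>i j. i \<in> {1..d} \<Longrightarrow> j \<in> {1..d} \<Longrightarrow> sphere_inner M (Q i) (Q j) = (if i = j then 1 else 0)"
    and span: "cfun.span (Q ` {1..d}) = harmonic_space M \<omega> m"
begin

lemma basis_harmonic: "j \<in> {1..d} \<Longrightarrow> Q j \<in> harmonic_space M \<omega> m"
  using cfun.span_base[of "Q j" "Q ` {1..d}"] span by simp

lemma basis_level: "j \<in> {1..d} \<Longrightarrow> Q j \<in> level_space \<omega> m"
  by (rule harmonic_space_level[OF basis_harmonic])

lemma basis_expansion:
  assumes "f \<in> harmonic_space M \<omega> m"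
  shows "f y = (\<Sum>j = 1..d. sphere_inner M f (Q j) * Q j y)"
proof -
  \<comment> \<open>The expansion is linear in \<open>f\<close>, which suits induction over the
    span; level membership is carried along because additivity of the inner product needs
    it.\<close>
  have "f \<in> level_space \<omega> m \<and> (\<forall>y. f y = (\<Sum>j = 1..d. sphere_inner M f (Q j) * Q j y))"
  proof (rule cfun.span_induct_alt[of f "Q ` {1..d}"])
    show "f \<in> cfun.span (Q ` {1..d})"
      using assms span by simp
    show "0 \<in> level_space \<omega> m \<and>
        (\<forall>y. (0 :: 'a ^ ('m option) \<Rightarrow> complex) y = (\<Sum>j = 1..d. sphere_inner M 0 (Q j) * Q j y))"
      using cfun.subspace_0[OF level_space_subspace] by (simp add: sphere_inner_zero)
  next
    fix c g h
    assume "g \<in> Q ` {1..d}" and h: "h \<in> level_space \<omega> m \<and> (\<forall>y. h y = (\<Sum>j = 1..d. sphere_inner M h (Q j) * Q j y))"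
    then obtain i where i: "i \<in> {1..d}" "g = Q i"
      by blast
    have cg: "fun_scale c g \<in> level_space \<omega> m"
      using i by (auto intro!: cfun.subspace_scale[OF level_space_subspace] basis_level)
    have "fun_scale c g + h \<in> level_space \<omega> m"
      using cg h by (blast intro: cfun.subspace_add[OF level_space_subspace])
    moreover have "(fun_scale c g + h) y = (\<Sum>j = 1..d. sphere_inner M (fun_scale c g + h) (Q j) * Q j y)" for y
    proof -
      have "sphere_inner M (fun_scale c g + h) (Q j) * Q j y
          = (if j = i then c * Q i y else 0) + sphere_inner M h (Q j) * Q j y" if j: "j \<in> {1..d}" for j
      proof -
        have "sphere_inner M (fun_scale c g + h) (Q j) = sphere_inner M (fun_scale c g) (Q j) + sphere_inner M h (Q j)"
          using cg h basis_level[OF j] by (intro sphere_inner_add[OF M, of _ \<omega> m]) auto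
        also have "sphere_inner M (fun_scale c g) (Q j) = (if j = i then c else 0)"
          using ortho[OF i(1) j] by (simp add: sphere_inner_scale i(2))
        finally have eq: "sphere_inner M (fun_scale c g + h) (Q j) = (if j = i then c else 0) + sphere_inner M h (Q j)" .
        show ?thesis
          unfolding eq by (simp add: distrib_right)
      qed
      then have "(\<Sum>j = 1..d. sphere_inner M (fun_scale c g + h) (Q j) * Q j y)
          = (\<Sum>j = 1..d. (if j = i then c * Q i y else 0) + sphere_inner M h (Q j) * Q j y)"
        by (rule sum.cong[OF refl])
      also have "\<dots> = c * Q i y + (\<Sum>j = 1..d. sphere_inner M h (Q j) * Q j y)"
        using i(1) by (simp add: sum.distrib)
      also have "\<dots> = (fun_scale c g + h) y"
        using spec[OF conjunct2[OF h], of y] i(2) by (simp add: fun_scale_def)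
      finally show ?thesis
        by simp
    qed
    ultimately show "fun_scale c g + h \<in> level_space \<omega> m \<and>
        (\<forall>y. (fun_scale c g + h) y = (\<Sum>j = 1..d. sphere_inner M (fun_scale c g + h) (Q j) * Q j y))"
      by blast
  qed
  then show ?thesis
    by blast
qed

text \<open>Translation by \<open>k\<close> is unitary with adjoint translation by
  \<open>matrix_inv k\<close>. Expanding the translated basis and exchanging the two sums moves the
  translation to the other argument.\<close>

lemma basis_kernel_translate:
  assumes k: "k \<in> GL_integers"
  shows "basis_kernel d Q (x v* k) y = basis_kernel d Q x (y v* matrix_inv k)"
proof -
  define T where "T = (\<lambda>i x. Q i (x v* k))"
  define T' where "T' = (\<lambda>i x. Q i (x v* matrix_inv k))"
  note k' = GL_integers_matrix_inv(1)[OF k]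
  have T: "T i \<in> harmonic_space M \<omega> m" and T': "T' i \<in> harmonic_space M \<omega> m" if "i \<in> {1..d}" for i
    unfolding T_def T'_def
    using harmonic_space_translate[OF M basis_harmonic[OF that]] k k' by blast+
  \<comment> \<open>Translating \<open>T' j\<close> by \<open>k\<close> returns \<open>Q j\<close>,
    so invariance of the inner product removes \<open>k\<close> from the first slot.\<close>
  have adj: "sphere_inner M (T i) (Q j) = cnj (sphere_inner M (T' j) (Q i))"
    if ij: "i \<in> {1..d}" "j \<in> {1..d}" for i j
  proof -
    have "sphere_inner M (T i) (Q j) = sphere_inner M (T i) (\<lambda>x. T' j (x v* k))"
      by (simp add: T'_def vector_matrix_matrix_inv(1)[OF k])
    also have "\<dots> = sphere_inner M (Q i) (T' j)"
      unfolding T_def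
      by (rule sphere_inner_translate[OF M basis_level[OF ij(1)] harmonic_space_level[OF T'[OF ij(2)]] k])
    also have "\<dots> = cnj (sphere_inner M (T' j) (Q i))"
      by (rule sphere_inner_commute)
    finally show ?thesis .
  qed
  have "basis_kernel d Q (x v* k) y = (\<Sum>i = 1..d. T i x * cnj (Q i y))"
    by (simp add: basis_kernel_def T_def)
  also have "\<dots> = (\<Sum>i = 1..d. (\<Sum>j = 1..d. sphere_inner M (T i) (Q j) * Q j x) * cnj (Q i y))"
    using basis_expansion[OF T] by (intro sum.cong) auto
  also have "\<dots> = (\<Sum>i = 1..d. \<Sum>j = 1..d. cnj (sphere_inner M (T' j) (Q i)) * Q j x * cnj (Q i y))"
    by (simp add: sum_distrib_right adj)
  also have "\<dots> = (\<Sum>j = 1..d. \<Sum>i = 1..d. cnj (sphere_inner M (T' j) (Q i)) * Q j x * cnj (Q i y))"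
    by (rule sum.swap)
  also have "\<dots> = (\<Sum>j = 1..d. Q j x * cnj (\<Sum>i = 1..d. sphere_inner M (T' j) (Q i) * Q i y))"
    by (simp add: sum_distrib_left mult_ac)
  also have "\<dots> = (\<Sum>j = 1..d. Q j x * cnj (T' j y))"
    using basis_expansion[OF T'] by (intro sum.cong) auto
  also have "\<dots> = basis_kernel d Q x (y v* matrix_inv k)"
    by (simp add: basis_kernel_def T'_def)
  finally show ?thesis .
qed

lemma basis_kernel_harmonic: "(\<lambda>x. basis_kernel d Q x y) \<in> harmonic_space M \<omega> m"
proof -
  have "(\<lambda>x. basis_kernel d Q x y) = (\<Sum>j = 1..d. fun_scale (cnj (Q j y)) (Q j))"
    by (rule ext) (simp add: basis_kernel_def fun_scale_def sum_fun_apply mult.commute)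
  also have "\<dots> \<in> harmonic_space M \<omega> m"
    using basis_harmonic
    by (intro cfun.subspace_sum[OF harmonic_space_subspace[OF M]] cfun.subspace_scale[OF harmonic_space_subspace[OF M]])
  finally show ?thesis .
qed

text \<open>The translation moves to the second argument, where the mirabolic group fixes
  \<open>e_last\<close>.\<close>

lemma basis_kernel_mirabolic:
  assumes k: "k \<in> mirabolic"
  shows "basis_kernel d Q (x v* k) e_last = basis_kernel d Q x e_last"
proof -
  have "e_last v* matrix_inv k = (e_last v* k) v* matrix_inv k"
    by (simp only: e_last_mirabolic[OF k])
  also have "\<dots> = (e_last :: 'a ^ ('m option))"
    by (rule vector_matrix_matrix_inv(1)[OF mirabolic_GL[OF k]])
  finally show ?thesis
    by (simp only: basis_kernel_translate[OF mirabolic_GL[OF k]])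
qed

text \<open>The kernel is constant on the diagonal, so its value there is its integral, the trace.\<close>

lemma basis_kernel_e_last: "basis_kernel d Q e_last e_last = of_nat d"
proof -
  interpret prob_space M
    using M by (simp add: haar_probability_def)
  have diag: "basis_kernel d Q (e_last v* k) (e_last v* k) = basis_kernel d Q e_last e_last"
    if "k \<in> space M" for k
  proof -
    have k: "k \<in> GL_integers"
      using that by (simp only: haar_probability_space[OF M])
    show ?thesis
      by (simp only: basis_kernel_translate[OF k] vector_matrix_matrix_inv(1)[OF k])
  qed
  have "basis_kernel d Q e_last e_last = (LINT k|M. basis_kernel d Q e_last e_last)"
    by (simp add: prob_space)
  also have "\<dots> = (LINT k|M. basis_kernel d Q (e_last v* k) (e_last v* k))"
    by (rule Bochner_Integration.integral_cong) (simp_all add: diag)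
  also have "\<dots> = (\<Sum>j = 1..d. sphere_inner M (Q j) (Q j))"
    unfolding basis_kernel_def sphere_inner_def
    by (intro Bochner_Integration.integral_sum sphere_inner_integrable[OF M, of _ \<omega> m] basis_level)
  also have "\<dots> = of_nat d"
    by (simp add: ortho)
  finally show ?thesis .
qed

text \<open>For nonzero \<open>d\<close>, the kernel divided by \<open>d\<close> gives existence of
  the zonal spherical function and the vanishing lemma gives uniqueness, so the definite description
  denotes it.\<close>

lemma basis_kernel_eq_zonal_spherical:
  assumes m: "conductor_exponent \<omega> \<le> m"
  shows "basis_kernel d Q x e_last = of_nat d * zonal_spherical M \<omega> m x"
proof (cases "d = 0")
  \<comment> \<open>The kernel is an empty sum, and the factor \<open>d\<close> annihilates whatever
    value the definite description takes.\<close>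
  case True
  then show ?thesis
    by (simp add: basis_kernel_def)
next
  case False
  define P where "P = fun_scale (inverse (of_nat d)) (\<lambda>x. basis_kernel d Q x e_last)"
  have P: "P \<in> harmonic_space M \<omega> m"
    unfolding P_def
    by (intro cfun.subspace_scale[OF harmonic_space_subspace[OF M]] basis_kernel_harmonic)
  have P_inv: "P (x v* k) = P x" if "k \<in> mirabolic" for x k
    using that by (simp add: P_def fun_scale_def basis_kernel_mirabolic)
  have P_e: "P e_last = 1"
    using False by (simp add: P_def fun_scale_def basis_kernel_e_last)
  have "zonal_spherical M \<omega> m = P"
    unfolding zonal_spherical_def
  proof (rule the_equality)
    show "P \<in> harmonic_space M \<omega> m \<and> (\<forall>x \<in> unit_sphere. \<forall>k \<in> mirabolic. P (x v* k) = P x) \<and> P e_last = 1"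
      using P P_inv P_e by blast
  next
    fix P'
    assume P': "P' \<in> harmonic_space M \<omega> m \<and>
      (\<forall>x \<in> unit_sphere. \<forall>k \<in> mirabolic. P' (x v* k) = P' x) \<and> P' e_last = 1"
    have "(P' - P) x = 0" for x
    proof (rule mirabolic_invariant_harmonic_eq_0[OF M _ m])
      show "P' - P \<in> harmonic_space M \<omega> m"
        using P P' by (blast intro: cfun.subspace_diff[OF harmonic_space_subspace[OF M]])
      show "(P' - P) (x v* k) = (P' - P) x" if "x \<in> unit_sphere" "k \<in> mirabolic" for x k
        using P' P_inv that by simp
      show "(P' - P) e_last = 0"
        using P' P_e by simp
    qed
    then show "P' = P"
      by (simp add: fun_eq_iff)
  qed
  then show ?thesis
    using False by (simp add: P_def fun_scale_def)
qed

end

theorem lemma3p14: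
  fixes M :: "('a::nonarch_local_field ^ ('m::finite option) ^ ('m option)) measure"
    and \<omega> :: "'a \<Rightarrow> complex" and m :: nat
    and Q :: "nat \<Rightarrow> ('a ^ ('m option) \<Rightarrow> complex)"
    and x :: "'a ^ ('m option)" and k :: "'a ^ ('m option) ^ ('m option)"
  assumes "haar_probability M"
    and "unit_character \<omega>"
    and "conductor_exponent \<omega> \<le> m"
    and "orthonormal_basis M (harmonic_space M \<omega> m) Q"
    and "x \<in> unit_sphere"
    and "k \<in> GL_integers"
  shows "(\<Sum>j = 1..cfun.dim (harmonic_space M \<omega> m). Q j x * cnj (Q j (e_last v* k)))
       = of_nat (cfun.dim (harmonic_space M \<omega> m)) * zonal_spherical M \<omega> m (x v* matrix_inv k)"
proof -
  define d where "d = cfun.dim (harmonic_space M \<omega> m)"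
  have ortho: "sphere_inner M (Q i) (Q j) = (if i = j then 1 else 0)"
    if "i \<in> {1..d}" "j \<in> {1..d}" for i j
    using assms(4) that unfolding orthonormal_basis_def d_def by blast
  have span: "cfun.span (Q ` {1..d}) = harmonic_space M \<omega> m"
    using assms(4) unfolding orthonormal_basis_def d_def by blast
  \<comment> \<open>Writing \<open>x\<close> as a translate by \<open>k\<close> lets the kernel
    identity cancel \<open>k\<close> in the second argument.\<close>
  have "basis_kernel d Q x (e_last v* k) = basis_kernel d Q ((x v* matrix_inv k) v* k) (e_last v* k)"
    by (simp only: vector_matrix_matrix_inv(2)[OF assms(6)])
  also have "\<dots> = basis_kernel d Q (x v* matrix_inv k) e_last"
    by (simp only: basis_kernel_translate[OF assms(1) ortho span assms(6)]
        vector_matrix_matrix_inv(1)[OF assms(6)])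
  also have "\<dots> = of_nat d * zonal_spherical M \<omega> m (x v* matrix_inv k)"
    by (rule basis_kernel_eq_zonal_spherical[OF assms(1) ortho span assms(3)])
  finally show ?thesis
    by (simp only: basis_kernel_def d_def)
qed

end
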